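(* Suppose that (i) $g$ and $\Phi$ are continuous, and (ii) for any $(H,h)\in\mathcal{H}\times\mathbb{R}^e$ with $h\ne0$ there exists $s\in\Omega$ such that $(H\cdot S)_T+hg<0$ along the path $s$. Let $c^n\in\mathbb{R}^e$ with $|c^n|\to0$. Then $$\lim_{n\to\infty}\overline\pi^n(\Phi)=\overline\pi(\Phi).$$ Furthermore, if $\Phi$ and $g$ are Lipschitz continuous and $|c^n|=O(1/2^n)$, then $$|\overline\pi^n(\Phi)-\overline\pi(\Phi)|=O(1/2^n).$$
   Context: $T,e\in\mathbb{N}$. $\Omega=\{1\}\times[a_1,b_1]\times\cdots\times[a_T,b_T]$ with $0\le a_T<\cdots<a_1<1<b_1<\cdots<b_T<\infty$ and all $a_i,b_i\in\mathbb{D}:=\bigcup_n\{0,1/2^n,2/2^n,\dots\}$. $\Omega^n:=\Omega\cap\{0,1/2^n,2/2^n,\dots\}^{T+1}$; only $n$ large enough that $a_i,b_i\in\{0,1/2^n,2/2^n,\dots\}$ for all $i$ are considered. $S=(S_0,\dots,S_T)$ is the canonical process $S_i(s_0,\dots,s_T)=s_i$. $|\cdot|$ denotes the sup norm. $\mathcal{H}$ is the set of trading strategies $H=(H_i)_{i=0}^{T-1}$, $H_i$ a real function on $\prod_{j=1}^i[a_j,b_j]$ (evaluated at $(s_1,\dots,s_i)$; $H_0$ a constant). $\mathcal{H}^n$ is the set of $H=(H_i)_{i=0}^{T-1}$ with $H_i$ a real function on $\prod_{j=1}^i\big([a_j,b_j]\cap\{0,1/2^n,2/2^n,\dots\}\big)$.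 $(H\cdot S)_T=\sum_{i=0}^{T-1}H_i(s_1,\dots,s_i)(s_{i+1}-s_i)$. $\mathcal{T}$ (resp. $\mathcal{T}^n$) is the set of stopping times $\tau:\Omega\to\{0,\dots,T\}$ (resp. $\tau:\Omega^n\to\{0,\dots,T\}$), meaning: if $\tau(s^1)=k$ and $s^1_i=s^2_i$ for $i=0,\dots,k$, then $\tau(s^2)=k$. $\mathcal{H}'$ is the set of maps $H:\mathcal{T}\to\mathcal{H}$ with $H_t(\tau^1)=H_t(\tau^2)$ for all $t<\tau^1\wedge\tau^2$ (i.e. at every path $s$ with $t<\tau^1(s)\wedge\tau^2(s)$), for all $\tau^1,\tau^2$; ${\mathcal{H}^n}'$ is defined in the same way as a set of maps $\mathcal{T}^n\to\mathcal{H}^n$. In an inequality indexed by $\tau$, $(H\cdot S)_T$ with $H\in\mathcal{H}'$ or ${\mathcal{H}^n}'$ means $(H(\tau)\cdot S)_T$. $g=(g_1,\dots,g_e):\Omega\to\mathbb{R}^e$ are the payoffs of options traded statically at time $0$ at price $0$ in the original market and at prices $c^n=(c^n_1,\dots,c^n_e)$ in the $n$-th discretized market; $hg$ is the inner product. $\Phi:\{0,\dots,T\}\times\Omega\to\mathbb{R}$ is the payoff of the American option, adapted ($\Phi_t(s)$ depends only on $(s_0,\dots,s_t)$); $\Phi_\tau(s)=\Phi_{\tau(s)}(s)$. Continuity (Lipschitz continuity) of $\Phi$ means that of each $\Phi_t$ in $s$. The super-hedging prices are $$\overline\pi(\Phi):=\inf\{x\in\mathbb{R}:\exists(H,h)\in\mathcal{H}'\times\mathbb{R}^e\text{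 s.t. }x+(H\cdot S)_T+hg\ge\Phi_\tau\ \ \forall s\in\Omega,\ \forall\tau\in\mathcal{T}\},$$ $$\overline\pi^n(\Phi):=\inf\{x\in\mathbb{R}:\exists(H,h)\in{\mathcal{H}^n}'\times\mathbb{R}^e\text{ s.t. }x+(H\cdot S)_T+h(g-c^n)\ge\Phi_\tau\ \ \forall s\in\Omega^n,\ \forall\tau\in\mathcal{T}^n\}.$$ *)

theory Defs
  imports "HOL-Analysis.Analysis" "HOL-Library.Landau_Symbols"
begin

text \<open>
  A market with horizon \<open>T\<close> is described by a family \<open>X\<close> of sets of admissible prices:
  \<open>X i\<close> is the set of possible values of the stock at time \<open>i\<close>. The original
  market and its discretizations are instances of the same definitions with different \<open>X\<close>.
  Functions on a restricted domain (paths, stopping times, strategies) are elements of the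
  extensional function spaces \<open>Pi\<^sub>E\<close>, so that they carry no information outside their domain.
\<close>

type_synonym path = "nat \<Rightarrow> real"

definition grid :: "nat \<Rightarrow> real set" where
  "grid n = range (\<lambda>k::nat. real k / 2 ^ n)"

definition dyadic :: "real set" where
  "dyadic = (\<Union>n. grid n)"

definition price_range :: "(nat \<Rightarrow> real) \<Rightarrow> (nat \<Rightarrow> real) \<Rightarrow> nat \<Rightarrow> real set" where
  "price_range a b i = (if i = 0 then {1} else {a i..b i})"

definition grid_price_range :: "(nat \<Rightarrow> real) \<Rightarrow> (nat \<Rightarrow> real) \<Rightarrow> nat \<Rightarrow> nat \<Rightarrow> real set" where
  "grid_price_range a b n i = price_range a b i \<inter> grid n"

definition paths :: "nat \<Rightarrow> (nat \<Rightarrow> real set) \<Rightarrow> path set" where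
  "paths T X = Pi\<^sub>E {0..T} X"

lemma paths_grid_price_range:
  "paths T (grid_price_range a b n) = paths T (price_range a b) \<inter> {s. \<forall>i\<in>{0..T}. s i \<in> grid n}"
  by (auto simp: paths_def grid_price_range_def PiE_iff)

text \<open>\<open>H i\<close> is a function of \<open>(s\<^sub>1, \<dots>, s\<^sub>i)\<close>, represented as a function
  on the index set \<open>{1..i}\<close>; for \<open>i = 0\<close> the domain is a singleton.\<close>

definition strategies :: "nat \<Rightarrow> (nat \<Rightarrow> real set) \<Rightarrow> (nat \<Rightarrow> path \<Rightarrow> real) set" where
  "strategies T X = (\<Pi>\<^sub>E i\<in>{..<T}. Pi\<^sub>E {1..i} X \<rightarrow>\<^sub>E UNIV)"

definition gain :: "nat \<Rightarrow> (nat \<Rightarrow> path \<Rightarrow> real) \<Rightarrow> path \<Rightarrow> real" where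
  "gain T H s = (\<Sum>i<T. H i (restrict s {1..i}) * (s (Suc i) - s i))"

definition stopping_times :: "nat \<Rightarrow> (nat \<Rightarrow> real set) \<Rightarrow> (path \<Rightarrow> nat) set" where
  "stopping_times T X =
     {\<tau> \<in> paths T X \<rightarrow>\<^sub>E {0..T}.
        \<forall>s1\<in>paths T X. \<forall>s2\<in>paths T X. \<forall>k.
          \<tau> s1 = k \<and> (\<forall>i\<in>{0..k}. s1 i = s2 i) \<longrightarrow> \<tau> s2 = k}"

text \<open>Strategies that may react to the exercise of the American option: the position at
  time \<open>t\<close> must not depend on a stopping time that has not occurred up to time \<open>t\<close>.\<close>

definition adapted_strategies ::
  "nat \<Rightarrow> (nat \<Rightarrow> real set) \<Rightarrow> ((path \<Rightarrow> nat) \<Rightarrow> nat \<Rightarrow> path \<Rightarrow> real) set" where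
  "adapted_strategies T X =
     {H \<in> stopping_times T X \<rightarrow>\<^sub>E strategies T X.
        \<forall>\<tau>1\<in>stopping_times T X. \<forall>\<tau>2\<in>stopping_times T X. \<forall>s\<in>paths T X. \<forall>t.
          t < min (\<tau>1 s) (\<tau>2 s) \<longrightarrow>
            H \<tau>1 t (restrict s {1..t}) = H \<tau>2 t (restrict s {1..t})}"

text \<open>Super-hedging price when the \<open>e\<close> options with payoffs \<open>f j\<close> (net of their
  prices) are available for static trading. Vectors in \<open>\<real>\<^sup>e\<close> are functions on the indices
  \<open>j < e\<close>. The infimum is taken in the extended reals, as the set may be empty or
  unbounded below.\<close>

definition superhedging_price ::
  "nat \<Rightarrow> (nat \<Rightarrow> real set) \<Rightarrow> nat \<Rightarrow> (nat \<Rightarrow> path \<Rightarrow> real) \<Rightarrow> (nat \<Rightarrow> path \<Rightarrow> real) \<Rightarrow> ereal" where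
  "superhedging_price T X e f \<Phi> =
     Inf (ereal ` {x. \<exists>H\<in>adapted_strategies T X. \<exists>h::nat \<Rightarrow> real.
       \<forall>s\<in>paths T X. \<forall>\<tau>\<in>stopping_times T X.
         x + gain T (H \<tau>) s + (\<Sum>j<e. h j * f j s) \<ge> \<Phi> (\<tau> s) s})"

definition price ::
  "nat \<Rightarrow> (nat \<Rightarrow> real) \<Rightarrow> (nat \<Rightarrow> real) \<Rightarrow> nat \<Rightarrow> (nat \<Rightarrow> path \<Rightarrow> real) \<Rightarrow> (nat \<Rightarrow> path \<Rightarrow> real) \<Rightarrow> ereal"
  where "price T a b e g \<Phi> = superhedging_price T (price_range a b) e g \<Phi>"

definition discrete_price ::
  "nat \<Rightarrow> (nat \<Rightarrow> real) \<Rightarrow> (nat \<Rightarrow> real) \<Rightarrow> nat \<Rightarrow> (nat \<Rightarrow> path \<Rightarrow> real) \<Rightarrow> (nat \<Rightarrow> real) \<Rightarrow>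
     (nat \<Rightarrow> path \<Rightarrow> real) \<Rightarrow> nat \<Rightarrow> ereal" where
  "discrete_price T a b e g c \<Phi> n =
     superhedging_price T (grid_price_range a b n) e (\<lambda>j s. g j s - c j) \<Phi>"

definition adapted_payoff ::
  "nat \<Rightarrow> (nat \<Rightarrow> real set) \<Rightarrow> (nat \<Rightarrow> path \<Rightarrow> real) \<Rightarrow> bool" where
  "adapted_payoff T X \<Phi> \<longleftrightarrow>
     (\<forall>t\<in>{0..T}. \<forall>s\<in>paths T X. \<forall>s'\<in>paths T X.
        (\<forall>i\<in>{0..t}. s i = s' i) \<longrightarrow> \<Phi> t s = \<Phi> t s')"

text \<open>Sup norm of the vector \<open>(v 0, \<dots>, v (m - 1))\<close>; the inserted \<open>0\<close> only matters
  for \<open>m = 0\<close>.\<close>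

definition sup_norm :: "nat \<Rightarrow> (nat \<Rightarrow> real) \<Rightarrow> real" where
  "sup_norm m v = Max (insert 0 ((\<lambda>i. \<bar>v i\<bar>) ` {..<m}))"

text \<open>Continuity on sets of paths refers to the library's product topology on
  \<^typ>\<open>nat \<Rightarrow> real\<close>, which on extensional functions over \<open>{0..T}\<close> is the topology of
  \<open>\<real>\<^sup>T\<^sup>+\<^sup>1\<close>. The library's metric on this type is not the sup norm, so
  Lipschitz continuity is stated explicitly.\<close>

definition lipschitz_paths :: "nat \<Rightarrow> path set \<Rightarrow> (path \<Rightarrow> real) \<Rightarrow> bool" where
  "lipschitz_paths T A f \<longleftrightarrow>
     (\<exists>L. \<forall>s\<in>A. \<forall>s'\<in>A. \<bar>f s - f s'\<bar> \<le> L * sup_norm (Suc T) (\<lambda>i. s i - s' i))"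

end

theory Submission imports Defs begin

text \<open>
  A strategy reacting to exercise amounts to one strategy for each constant exercise date \<open>k\<close>,
  where the strategies for \<open>k\<close> and \<open>l\<close> agree before time \<open>min k l\<close>: follow the strategy for
  date \<open>T\<close> until exercise, then switch. Stopping times thereby disappear from the comparison. A
  hedge of the original market restricts to the grid, and a hedge on the grid is pulled back along
  rounding down of prices, at a cost proportional to the size of its positions and to the static
  position \<open>h\<close>. Positions are bounded because the price ranges widen strictly: from any price,
  both an up and a down move of some fixed size \<open>d\<close> are possible. By compactness, absence of arbitrage
  yields \<open>\<delta> > 0\<close> such that financing a static position \<open>h\<close> costs at least \<open>\<delta> (\<Sum>j. \<bar>h j\<bar>)\<close>. This
  passes to fine grids with \<open>\<delta> / 2\<close> and bounds \<open>h\<close> for all relevant hedges.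
\<close>

section \<open>Reduction to constant exercise dates\<close>

text \<open>Membership in \<open>strategies\<close> demands extensional functions. Cutting off the
  irrelevant values achieves it and leaves the gain on every path of \<open>X\<close>
  unchanged.\<close>

definition strategy_restrict ::
  "nat \<Rightarrow> (nat \<Rightarrow> real set) \<Rightarrow> (nat \<Rightarrow> path \<Rightarrow> real) \<Rightarrow> nat \<Rightarrow> path \<Rightarrow> real" where
  "strategy_restrict T X H = (\<lambda>i\<in>{..<T}. \<lambda>u\<in>Pi\<^sub>E {1..i} X. H i u)"

lemma strategy_restrict_in_strategies: "strategy_restrict T X H \<in> strategies T X"
  by (auto simp: strategy_restrict_def strategies_def)

lemma restrict_path_in:
  assumes "s \<in> paths T X" "i \<le> T"
  shows "restrict s {1..i} \<in> Pi\<^sub>E {1..i} X"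
  using assms by (auto simp: paths_def PiE_iff)

lemma gain_cong:
  assumes "\<And>t. t < T \<Longrightarrow> H t (restrict s {1..t}) = H' t (restrict s {1..t})"
  shows "gain T H s = gain T H' s"
  using assms by (auto simp: gain_def intro!: sum.cong)

lemma gain_strategy_restrict:
  assumes "s \<in> paths T X"
  shows "gain T (strategy_restrict T X H) s = gain T H s"
  using restrict_path_in[OF assms] by (intro gain_cong) (simp add: strategy_restrict_def)

lemma const_in_stopping_times: "k \<le> T \<Longrightarrow> (\<lambda>s\<in>paths T X. k) \<in> stopping_times T X"
  by (auto simp: stopping_times_def)

text \<open>\<open>H k\<close> is the strategy for exercise at the constant date \<open>k\<close>, to superhedge \<open>F k\<close>; its values off the
  paths of \<open>X\<close> are irrelevant.\<close>

definition dated_hedge ::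
  "nat \<Rightarrow> (nat \<Rightarrow> real set) \<Rightarrow> (nat \<Rightarrow> path \<Rightarrow> real) \<Rightarrow> (nat \<Rightarrow> nat \<Rightarrow> path \<Rightarrow> real) \<Rightarrow> bool" where
  "dated_hedge T X F H \<longleftrightarrow>
     (\<forall>k\<le>T. \<forall>l\<le>T. \<forall>t<min k l. \<forall>s\<in>paths T X.
        H k t (restrict s {1..t}) = H l t (restrict s {1..t})) \<and>
     (\<forall>k\<le>T. \<forall>s\<in>paths T X. F k s \<le> gain T (H k) s)"

lemma dated_hedgeD:
  assumes "dated_hedge T X F H" "k \<le> T" "s \<in> paths T X"
  shows "F k s \<le> gain T (H k) s"
  using assms by (auto simp: dated_hedge_def)

lemma dated_hedge_before:
  assumes "dated_hedge T X F H" "k \<le> T" "l \<le> T" "t < min k l" "s \<in> paths T X"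
  shows "H k t (restrict s {1..t}) = H l t (restrict s {1..t})"
  using assms unfolding dated_hedge_def by blast

text \<open>One direction inserts the constant stopping times. In the other, the strategy for date
  \<open>T\<close> is run until exercise is observed and the strategy for the observed date
  afterwards; since the two agree before exercise, the switch changes nothing. Price 1 is always
  admissible, so partial paths can be completed.\<close>

lemma adapted_strategies_iff_dated_hedge:
  assumes X: "\<And>i. i \<le> T \<Longrightarrow> 1 \<in> X i" "X 0 = {1}"
  shows "(\<exists>H\<in>adapted_strategies T X. \<forall>s\<in>paths T X. \<forall>\<tau>\<in>stopping_times T X.
            F (\<tau> s) s \<le> gain T (H \<tau>) s) \<longleftrightarrow> (\<exists>H. dated_hedge T X F H)"
    (is "?L = ?R")
proof
  assume ?L
  then obtain H where H: "H \<in> adapted_strategies T X"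
    and hedge: "\<And>s \<tau>. s \<in> paths T X \<Longrightarrow> \<tau> \<in> stopping_times T X \<Longrightarrow> F (\<tau> s) s \<le> gain T (H \<tau>) s"
    by blast
  define H' where "H' k = H (\<lambda>s\<in>paths T X. k)" for k :: nat
  have "H' k t (restrict s {1..t}) = H' l t (restrict s {1..t})"
    if "k \<le> T" "l \<le> T" "t < min k l" "s \<in> paths T X" for k l t s
  proof -
    have "t < min ((\<lambda>s\<in>paths T X. k) s) ((\<lambda>s\<in>paths T X. l) s)"
      using that by simp
    then show ?thesis
      using H const_in_stopping_times[OF that(1), of X] const_in_stopping_times[OF that(2), of X] that(4)
      unfolding adapted_strategies_def H'_def by blast
  qed
  moreover have "F k s \<le> gain T (H' k) s" if "k \<le> T" "s \<in> paths T X" for k s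
    using hedge[OF that(2) const_in_stopping_times[OF that(1)]] that by (simp add: H'_def)
  ultimately show ?R
    unfolding dated_hedge_def by blast
next
  assume ?R
  then obtain H where H: "dated_hedge T X F H" by blast
  txt \<open>\<open>P u t\<close> completes the prices \<open>u\<close> up to time \<open>t\<close> to a path, on which \<open>\<tau>\<close> tells whether exercise has
    occurred by time \<open>t\<close>.\<close>
  define P where "P u t = (\<lambda>i\<in>{0..T}. if i \<in> {1..t} then u i else 1)" for u :: path and t :: nat
  have P_paths: "P (restrict s {1..t}) t \<in> paths T X"
    and P_eq: "\<forall>i\<in>{0..t}. P (restrict s {1..t}) t i = s i"
    if "s \<in> paths T X" "t < T" for s t
  proof -
    show "P (restrict s {1..t}) t \<in> paths T X"
      using that X(1) by (auto simp: paths_def PiE_iff P_def)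
    have "s 0 \<in> X 0"
      using that by (auto simp: paths_def PiE_iff)
    then have "s 0 = 1"
      using X(2) by simp
    then show "\<forall>i\<in>{0..t}. P (restrict s {1..t}) t i = s i"
      using that by (auto simp: P_def not_less_eq_eq)
  qed
  \<comment> \<open>The date whose strategy is in force at time \<open>t\<close>: the exercise date
    once it has passed, and \<open>T\<close> as long as exercise is outstanding.\<close>
  define D where "D \<tau> t u = (if \<tau> (P u t) \<le> t then \<tau> (P u t) else T)" for \<tau> :: "path \<Rightarrow> nat" and t u
  have D: "D \<tau> t (restrict s {1..t}) = (if \<tau> s \<le> t then \<tau> s else T)"
    if "s \<in> paths T X" "t < T" "\<tau> \<in> stopping_times T X" for s t \<tau>
  proof -
    let ?p = "P (restrict s {1..t}) t"
    have stop: "\<And>s1 s2 k. s1 \<in> paths T X \<Longrightarrow> s2 \<in> paths T X \<Longrightarrow> \<tau> s1 = k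
        \<Longrightarrow> (\<forall>i\<in>{0..k}. s1 i = s2 i) \<Longrightarrow> \<tau> s2 = k"
      using that(3) unfolding stopping_times_def by blast
    \<comment> \<open>The completed path agrees with \<open>s\<close> up to time \<open>t\<close>,
      so the stopping property carries an exercise by time \<open>t\<close> from either path to the
      other.\<close>
    have "\<tau> ?p = \<tau> s" if "\<tau> s \<le> t"
      using P_eq[OF \<open>s \<in> paths T X\<close> \<open>t < T\<close>] that
      by (intro stop[OF \<open>s \<in> paths T X\<close> P_paths[OF \<open>s \<in> paths T X\<close> \<open>t < T\<close>] refl]) simp
    moreover have "\<tau> s = \<tau> ?p" if "\<tau> ?p \<le> t"
      using P_eq[OF \<open>s \<in> paths T X\<close> \<open>t < T\<close>] that
      by (intro stop[OF P_paths[OF \<open>s \<in> paths T X\<close> \<open>t < T\<close>] \<open>s \<in> paths T X\<close> refl]) simp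
    ultimately show ?thesis
      unfolding D_def by (smt (verit))
  qed
  have \<tau>_le: "\<tau> s \<le> T" if "s \<in> paths T X" "\<tau> \<in> stopping_times T X" for s \<tau>
  proof -
    have "\<tau> \<in> paths T X \<rightarrow>\<^sub>E {0..T}"
      using that(2) unfolding stopping_times_def by blast
    then show ?thesis
      using that(1) by (auto dest: PiE_mem)
  qed
  define H' where "H' = (\<lambda>\<tau>\<in>stopping_times T X. strategy_restrict T X (\<lambda>t u. H (D \<tau> t u) t u))"
  have H'_eq: "H' \<tau> t (restrict s {1..t}) = H (if \<tau> s \<le> t then \<tau> s else T) t (restrict s {1..t})"
    if "s \<in> paths T X" "t < T" "\<tau> \<in> stopping_times T X" for s t \<tau>
    using D[OF that] restrict_path_in[OF that(1), of t] that by (simp add: H'_def strategy_restrict_def)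
  have "H' \<in> adapted_strategies T X"
    unfolding adapted_strategies_def
  proof (intro CollectI conjI ballI allI impI)
    show "H' \<in> stopping_times T X \<rightarrow>\<^sub>E strategies T X"
      by (auto simp: H'_def strategy_restrict_in_strategies)
    fix \<tau>1 \<tau>2 s t
    assume \<tau>: "\<tau>1 \<in> stopping_times T X" "\<tau>2 \<in> stopping_times T X" and s: "s \<in> paths T X"
      and t: "t < min (\<tau>1 s) (\<tau>2 s)"
    have "t < T"
      using t \<tau>_le[OF s \<tau>(1)] by simp
    then show "H' \<tau>1 t (restrict s {1..t}) = H' \<tau>2 t (restrict s {1..t})"
      using H'_eq[OF s _ \<tau>(1), of t] H'_eq[OF s _ \<tau>(2), of t] t by simp
  qed
  moreover have "F (\<tau> s) s \<le> gain T (H' \<tau>) s" if s: "s \<in> paths T X" and \<tau>: "\<tau> \<in> stopping_times T X" for s \<tau>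
  proof -
    have "gain T (H' \<tau>) s = gain T (H (\<tau> s)) s"
    proof (rule gain_cong)
      fix t assume "t < T"
      have "H T t (restrict s {1..t}) = H (\<tau> s) t (restrict s {1..t})" if "t < \<tau> s"
        using dated_hedge_before[OF H order_refl \<tau>_le[OF s \<tau>] _ s] that \<open>t < T\<close> by simp
      then show "H' \<tau> t (restrict s {1..t}) = H (\<tau> s) t (restrict s {1..t})"
        using H'_eq[OF s \<open>t < T\<close> \<tau>] by simp
    qed
    then show ?thesis
      using dated_hedgeD[OF H \<tau>_le[OF s \<tau>] s] by simp
  qed
  ultimately show ?L by blast
qed

section \<open>Bounds on positions\<close>

text \<open>Only the features needed to bound positions are kept. The constants \<open>d\<close> and
  \<open>B\<close> are parameters so that the original market and all fine grids can share
  them.\<close>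

locale market =
  fixes T :: nat and X :: "nat \<Rightarrow> real set" and d B :: real
  assumes d_pos: "0 < d" and B_nonneg: "0 \<le> B"
    and initial: "X 0 = {1}"
    and mono: "i \<le> j \<Longrightarrow> j \<le> T \<Longrightarrow> X i \<subseteq> X j"
    and spread_down: "t < T \<Longrightarrow> y \<in> X t \<Longrightarrow> \<exists>v\<in>X (Suc t). v \<le> y - d"
    and spread_up: "t < T \<Longrightarrow> y \<in> X t \<Longrightarrow> \<exists>v\<in>X (Suc t). y + d \<le> v"
    and step: "t < T \<Longrightarrow> y \<in> X t \<Longrightarrow> z \<in> X (Suc t) \<Longrightarrow> \<bar>z - y\<bar> \<le> B"
begin

lemma one_mem: "i \<le> T \<Longrightarrow> 1 \<in> X i"
  using mono[of 0 i] initial by simp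

lemma const_path: "(\<lambda>i\<in>{0..T}. 1) \<in> paths T X"
  using one_mem by (auto simp: paths_def)

lemma gain_const_path: "gain T H (\<lambda>i\<in>{0..T}. 1) = 0"
  by (auto simp: gain_def intro!: sum.neutral)

lemma superhedging_price_dated:
  "superhedging_price T X e f \<Phi> =
     Inf (ereal ` {x. \<exists>H h. dated_hedge T X (\<lambda>k s. \<Phi> k s - x - (\<Sum>j<e. h j * f j s)) H})"
proof -
  have "(\<exists>H\<in>adapted_strategies T X. \<exists>h::nat \<Rightarrow> real.
       \<forall>s\<in>paths T X. \<forall>\<tau>\<in>stopping_times T X.
         x + gain T (H \<tau>) s + (\<Sum>j<e. h j * f j s) \<ge> \<Phi> (\<tau> s) s) \<longleftrightarrow>
     (\<exists>H h. dated_hedge T X (\<lambda>k s. \<Phi> k s - x - (\<Sum>j<e. h j * f j s)) H)" (is "?L \<longleftrightarrow> ?R") for x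
  proof -
    have shift: "x + G + c \<ge> p \<longleftrightarrow> p - x - c \<le> G" for G c p :: real
      by linarith
    have "?L \<longleftrightarrow> (\<exists>h::nat \<Rightarrow> real. \<exists>H\<in>adapted_strategies T X.
        \<forall>s\<in>paths T X. \<forall>\<tau>\<in>stopping_times T X.
          \<Phi> (\<tau> s) s - x - (\<Sum>j<e. h j * f j s) \<le> gain T (H \<tau>) s)"
      unfolding shift by blast
    also have "\<dots> \<longleftrightarrow> (\<exists>h. \<exists>H. dated_hedge T X (\<lambda>k s. \<Phi> k s - x - (\<Sum>j<e. h j * f j s)) H)"
      by (intro ex_cong1 adapted_strategies_iff_dated_hedge one_mem initial)
    also have "\<dots> \<longleftrightarrow> ?R"
      by (rule ex_comm)
    finally show ?thesis .
  qed
  then show ?thesis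
    unfolding superhedging_price_def by simp
qed

text \<open>Stopping all trading right after an adverse move of size at least \<open>d\<close> must not lose more
  than \<open>K\<close>, so the position is bounded by the current wealth plus \<open>K\<close>.\<close>

lemma position_le_wealth:
  assumes K: "\<And>s. s \<in> paths T X \<Longrightarrow> - K \<le> gain T H s" and t: "t < T" and s: "s \<in> paths T X"
  shows "\<bar>H t (restrict s {1..t})\<bar> * d \<le> K + gain t H s"
proof -
  have st: "s t \<in> X t"
    using s t by (auto simp: paths_def PiE_iff)
  \<comment> \<open>The price moves against the sign of the position: down for a long one, up for a
    short one.\<close>
  obtain v where v: "v \<in> X (Suc t)" "H t (restrict s {1..t}) * (v - s t) \<le> - \<bar>H t (restrict s {1..t})\<bar> * d"
  proof (cases "H t (restrict s {1..t}) \<ge> 0")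
    case True
    obtain v where "v \<in> X (Suc t)" "v \<le> s t - d"
      using spread_down[OF t st] by blast
    with True show ?thesis
      using mult_left_mono[of "v - s t" "- d" "H t (restrict s {1..t})"] by (intro that[of v]) auto
  next
    case False
    obtain v where "v \<in> X (Suc t)" "s t + d \<le> v"
      using spread_up[OF t st] by blast
    with False show ?thesis
      using mult_left_mono_neg[of d "v - s t" "H t (restrict s {1..t})"] by (intro that[of v]) auto
  qed
  \<comment> \<open>Trading is stopped by freezing the price at \<open>v\<close>. Monotonicity of
    \<open>X\<close> keeps \<open>v\<close> admissible, and all increments after time
    \<open>Suc t\<close> vanish.\<close>
  define s' where "s' = (\<lambda>i\<in>{0..T}. if i \<le> t then s i else v)"
  have "v \<in> X i" if "t < i" "i \<le> T" for i
    using v(1) mono[of "Suc t" i] that by auto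
  then have "s' \<in> paths T X"
    using s by (auto simp: s'_def paths_def PiE_iff)
  then have "- K \<le> gain T H s'" by (rule K)
  also have "gain T H s' = gain (Suc t) H s'"
    unfolding gain_def using t
    by (intro sum.mono_neutral_right) (auto simp: s'_def)
  also have "\<dots> = gain t H s + H t (restrict s {1..t}) * (v - s t)"
  proof -
    have "restrict s' {1..i} = restrict s {1..i}" if "i \<le> t" for i
      using that t by (auto simp: s'_def restrict_def)
    then show ?thesis
      using t by (simp add: gain_def s'_def)
  qed
  finally show ?thesis using v(2) by simp
qed

text \<open>A discrete Gronwall argument: the position is at most
  \<open>(K + gain t H s) / d\<close> and the price moves by at most \<open>B\<close>, so
  \<open>K\<close> plus wealth grows by at most the factor \<open>1 + B / d\<close> per
  step.\<close>

lemma wealth_growth: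
  assumes K: "\<And>s. s \<in> paths T X \<Longrightarrow> - K \<le> gain T H s" and s: "s \<in> paths T X"
  shows "t \<le> T \<Longrightarrow> K + gain t H s \<le> K * (1 + B / d) ^ t"
proof (induction t)
  case 0
  show ?case by (simp add: gain_def)
next
  case (Suc t)
  let ?h = "H t (restrict s {1..t})"
  have t: "t < T" using Suc by simp
  have st: "s t \<in> X t" "s (Suc t) \<in> X (Suc t)"
    using s t by (auto simp: paths_def PiE_iff)
  have h: "\<bar>?h\<bar> \<le> (K + gain t H s) / d"
    using position_le_wealth[OF K t s] d_pos by (simp add: field_simps)
  have "?h * (s (Suc t) - s t) \<le> \<bar>?h\<bar> * \<bar>s (Suc t) - s t\<bar>"
    by (metis abs_ge_self abs_mult)
  also have "\<dots> \<le> (K + gain t H s) / d * B"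
    using h step[OF t st] by (intro mult_mono) auto
  finally have "K + gain (Suc t) H s \<le> K + gain t H s + (K + gain t H s) / d * B"
    by (simp add: gain_def)
  also have "\<dots> = (K + gain t H s) * (1 + B / d)"
    by (simp add: distrib_left)
  also have "\<dots> \<le> K * (1 + B / d) ^ t * (1 + B / d)"
    using Suc B_nonneg d_pos by (intro mult_right_mono) auto
  finally show ?case by (simp add: algebra_simps)
qed

text \<open>The constant of \<open>position_bound\<close>. It depends on \<open>T\<close>,
  \<open>d\<close> and \<open>B\<close> only, hence not on the grid.\<close>

definition A :: real where "A = (1 + B / d) ^ T / d"

lemma A_nonneg: "0 \<le> A"
  using d_pos B_nonneg by (simp add: A_def)

lemma position_bound:
  assumes K: "\<And>s. s \<in> paths T X \<Longrightarrow> - K \<le> gain T H s" and t: "t < T" and s: "s \<in> paths T X"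
  shows "\<bar>H t (restrict s {1..t})\<bar> \<le> A * K"
proof -
  have "0 \<le> K"
    using K[OF const_path] gain_const_path by simp
  have "\<bar>H t (restrict s {1..t})\<bar> * d \<le> K * (1 + B / d) ^ t"
    using position_le_wealth[OF K t s] wealth_growth[OF K s, of t] t by simp
  also have "\<dots> \<le> K * (1 + B / d) ^ T"
    using \<open>0 \<le> K\<close> B_nonneg d_pos t by (intro mult_left_mono power_increasing) auto
  finally show ?thesis using d_pos by (simp add: A_def field_simps)
qed

end

section \<open>Cost of static positions\<close>

lemma compact_PiE_UNIV:
  fixes S :: "'i \<Rightarrow> 'a::topological_space set"
  assumes "\<And>i. compact (S i)"
  shows "compact (Pi\<^sub>E UNIV S)"
proof -
  have "compactin (product_topology (\<lambda>i. euclidean) UNIV) (Pi\<^sub>E UNIV S)"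
    using assms by (simp add: compactin_PiE)
  then show ?thesis
    by (simp add: euclidean_product_topology)
qed

lemma compact_paths:
  assumes "\<And>i. i \<le> T \<Longrightarrow> compact (X i)"
  shows "compact (paths T X)"
proof -
  \<comment> \<open>Extensionality pins the coordinates beyond \<open>T\<close> to
    \<open>undefined\<close>, so the set is a full product of compact factors.\<close>
  have "paths T X = Pi\<^sub>E UNIV (\<lambda>i. if i \<le> T then X i else {undefined})"
    by (force simp: paths_def PiE_iff extensional_def split: if_splits)
  then show ?thesis
    using assms by (simp add: compact_PiE_UNIV)
qed


lemma compact_family_bounded:
  fixes f :: "'i \<Rightarrow> 'a::topological_space \<Rightarrow> real"
  assumes "finite I" "compact S" "\<And>i. i \<in> I \<Longrightarrow> continuous_on S (f i)"
  shows "\<exists>G\<ge>0. \<forall>i\<in>I. \<forall>s\<in>S. \<bar>f i s\<bar> \<le> G"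
proof -
  have "bounded (f i ` S)" if "i \<in> I" for i
    using compact_continuous_image[OF assms(3)[OF that] assms(2)] by (rule compact_imp_bounded)
  then have "bounded (\<Union>i\<in>I. f i ` S)"
    using assms(1) by blast
  then obtain G where "\<forall>y\<in>(\<Union>i\<in>I. f i ` S). norm y \<le> G"
    unfolding bounded_iff by blast
  then have "\<forall>i\<in>I. \<forall>s\<in>S. \<bar>f i s\<bar> \<le> \<bar>G\<bar>"
    by (force intro: order_trans[OF _ abs_ge_self])
  then show ?thesis
    by (intro exI[of _ "\<bar>G\<bar>"]) simp
qed

lemma abs_sum_mult_le:
  fixes h f :: "'i \<Rightarrow> real"
  assumes "\<And>j. j \<in> I \<Longrightarrow> \<bar>f j\<bar> \<le> G"
  shows "\<bar>\<Sum>j\<in>I. h j * f j\<bar> \<le> (\<Sum>j\<in>I. \<bar>h j\<bar>) * G"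
proof -
  have "\<bar>\<Sum>j\<in>I. h j * f j\<bar> \<le> (\<Sum>j\<in>I. \<bar>h j * f j\<bar>)"
    by (rule sum_abs)
  also have "\<dots> \<le> (\<Sum>j\<in>I. \<bar>h j\<bar> * G)"
    using assms by (intro sum_mono) (auto simp: abs_mult intro: mult_left_mono)
  finally show ?thesis
    by (simp add: sum_distrib_right)
qed

lemma gain_scale: "gain T (\<lambda>i u. c * H i u) s = c * gain T H s"
  by (simp add: gain_def sum_distrib_left mult.assoc)

text \<open>Quantitative absence of arbitrage: the case \<open>x = 0\<close> forces a vanishing
  static position. \<open>H\<close> ranges over all functions, because values off the paths do not
  affect the gain.\<close>

definition coercive ::
  "nat \<Rightarrow> (nat \<Rightarrow> real set) \<Rightarrow> nat \<Rightarrow> (nat \<Rightarrow> path \<Rightarrow> real) \<Rightarrow> real \<Rightarrow> bool" where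
  "coercive T X e f \<delta> \<longleftrightarrow> 0 < \<delta> \<and>
     (\<forall>H h x. (\<forall>s\<in>paths T X. - x \<le> gain T H s + (\<Sum>j<e. h j * f j s)) \<longrightarrow>
        \<delta> * (\<Sum>j<e. \<bar>h j\<bar>) \<le> x)"

lemma coerciveD:
  assumes "coercive T X e f \<delta>"
    and "\<And>s. s \<in> paths T X \<Longrightarrow> - x \<le> gain T H s + (\<Sum>j<e. h j * f j s)"
  shows "\<delta> * (\<Sum>j<e. \<bar>h j\<bar>) \<le> x"
  using assms unfolding coercive_def by blast

text \<open>Strategies are uncurried into points of one product space over pairs of a time and a
  price history. Each condition involves finitely many coordinates and is therefore closed in the
  product topology.\<close>

lemma closed_near_arbitrages:
  "closed {z::(nat \<times> path \<Rightarrow> real) \<times> (nat \<Rightarrow> real). (\<Sum>j<e. \<bar>snd z j\<bar>) = 1 \<and>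
     (\<forall>s\<in>S. y \<le> gain T (\<lambda>i u. fst z (i, u)) s + (\<Sum>j<e. snd z j * g j s))}"
proof -
  have fst: "continuous_on UNIV (\<lambda>z::(nat \<times> path \<Rightarrow> real) \<times> (nat \<Rightarrow> real). fst z p)" for p
    by (rule continuous_on_product_then_coordinatewise) (intro continuous_intros)
  have snd: "continuous_on UNIV (\<lambda>z::(nat \<times> path \<Rightarrow> real) \<times> (nat \<Rightarrow> real). snd z j)" for j
    by (rule continuous_on_product_then_coordinatewise) (intro continuous_intros)
  have "closed {z::(nat \<times> path \<Rightarrow> real) \<times> (nat \<Rightarrow> real).
      y \<le> gain T (\<lambda>i u. fst z (i, u)) s + (\<Sum>j<e. snd z j * g j s)}" for s
    unfolding gain_def by (intro closed_Collect_le continuous_intros fst snd)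
  moreover have "closed {z::(nat \<times> path \<Rightarrow> real) \<times> (nat \<Rightarrow> real). (\<Sum>j<e. \<bar>snd z j\<bar>) = 1}"
    by (intro closed_Collect_eq continuous_intros snd)
  ultimately show ?thesis
    unfolding Ball_def by (intro closed_Collect_conj closed_Collect_all closed_Collect_imp open_Collect_const)
qed

text \<open>Near-arbitrages with a normalised static part have uniformly bounded positions, so by
  Tychonoff's theorem they would accumulate at an arbitrage.\<close>

lemma (in market) coercive:
  assumes G: "\<And>j s. j < e \<Longrightarrow> s \<in> paths T X \<Longrightarrow> \<bar>g j s\<bar> \<le> G"
    and no_arbitrage: "\<And>H h. H \<in> strategies T X \<Longrightarrow> \<exists>j<e. h j \<noteq> 0 \<Longrightarrow>
      \<exists>s\<in>paths T X. gain T H s + (\<Sum>j<e. h j * g j s) < 0"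
  shows "\<exists>\<delta>. coercive T X e g \<delta>"
proof -
  \<comment> \<open>For a normalised near-arbitrage the static part is at most \<open>G\<close> and
    the tolerance at most 1, so trading loses at most \<open>1 + G\<close> and
    \<open>position_bound\<close> applies. The absolute value puts 0 into
    \<open>{-R..R}\<close>.\<close>
  define R where "R = \<bar>A * (1 + G)\<bar>"
  define K where "K = Pi\<^sub>E UNIV (\<lambda>_::nat \<times> path. {-R..R}) \<times> Pi\<^sub>E UNIV (\<lambda>_::nat. {-1..1::real})"
  define C where "C m = {z::(nat \<times> path \<Rightarrow> real) \<times> (nat \<Rightarrow> real). (\<Sum>j<e. \<bar>snd z j\<bar>) = 1 \<and>
     (\<forall>s\<in>paths T X. - (1 / real (Suc m)) \<le> gain T (\<lambda>i u. fst z (i, u)) s + (\<Sum>j<e. snd z j * g j s))}"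
    for m
  have "compact K"
    unfolding K_def by (intro compact_Times compact_PiE_UNIV compact_Icc)
  have closed: "closed (C m)" for m
    unfolding C_def by (rule closed_near_arbitrages)
  have decreasing: "C m \<subseteq> C k" if "k \<le> m" for k m
  proof -
    have "- (1 / real (Suc k)) \<le> - (1 / real (Suc m))"
      using that by (simp add: frac_le)
    then show ?thesis
      unfolding C_def by (auto intro: order_trans)
  qed
  have "\<exists>m. \<forall>H h. (\<Sum>j<e. \<bar>h j\<bar>) = 1 \<longrightarrow>
    \<not> (\<forall>s\<in>paths T X. - (1 / real (Suc m)) \<le> gain T H s + (\<Sum>j<e. h j * g j s))"
  proof (rule ccontr)
    assume contra: "\<not> ?thesis"
    have nonempty: "K \<inter> C m \<noteq> {}" for m
    proof -
      obtain H h where h: "(\<Sum>j<e. \<bar>h j\<bar>) = 1"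
        and H: "\<And>s. s \<in> paths T X \<Longrightarrow> - (1 / real (Suc m)) \<le> gain T H s + (\<Sum>j<e. h j * g j s)"
        using contra by blast
      have "- (1 + G) \<le> gain T H s" if "s \<in> paths T X" for s
      proof -
        have "\<bar>\<Sum>j<e. h j * g j s\<bar> \<le> G"
          using abs_sum_mult_le[of "{..<e}" "\<lambda>j. g j s" G h] G that h by simp
        moreover have "1 / real (Suc m) \<le> 1" by simp
        ultimately show ?thesis
          using H[OF that] by linarith
      qed
      then have bound: "\<bar>H t (restrict s {1..t})\<bar> \<le> R" if "t < T" "s \<in> paths T X" for t s
        unfolding R_def using position_bound[of "1 + G" H] that by (meson abs_ge_self order_trans)
      \<comment> \<open>Resetting to 0 affects only values off the paths and indices from
        \<open>e\<close> on. It moves the pair into the compact set \<open>K\<close> without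
        changing any payoff.\<close>
      define z where "z = ((\<lambda>(i, u). if \<bar>H i u\<bar> \<le> R then H i u else 0), \<lambda>j. if j < e then h j else 0)"
      have "gain T (\<lambda>i u. fst z (i, u)) s = gain T H s" if "s \<in> paths T X" for s
        using bound that by (intro gain_cong) (simp add: z_def)
      then have "z \<in> C m"
        using h H by (simp add: C_def z_def)
      moreover have "\<bar>h j\<bar> \<le> 1" if "j < e" for j
        using member_le_sum[of j "{..<e}" "\<lambda>j. \<bar>h j\<bar>"] h that by simp
      then have "z \<in> K"
        by (auto simp: K_def z_def R_def abs_le_iff minus_le_iff)
      ultimately show ?thesis by blast
    qed
    have "K \<inter> (\<Inter>m\<in>UNIV. C m) \<noteq> {}"
    proof (rule compact_imp_fip_image[OF \<open>compact K\<close> closed])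
      fix I :: "nat set" assume "finite I"
      \<comment> \<open>The sets are nested, so a finite intersection contains the one with the
        largest index; the inserted 0 covers empty \<open>I\<close>.\<close>
      then have "C (Max (insert 0 I)) \<subseteq> (\<Inter>m\<in>I. C m)"
        by (intro INT_greatest decreasing Max_ge) auto
      then show "K \<inter> (\<Inter>m\<in>I. C m) \<noteq> {}"
        using nonempty[of "Max (insert 0 I)"] by blast
    qed
    then obtain z where z: "\<And>m. z \<in> C m" by blast
    have "\<exists>j<e. snd z j \<noteq> 0"
    proof (rule ccontr)
      assume "\<not> ?thesis"
      then show False using z[of 0] by (auto simp: C_def)
    qed
    then obtain s where s: "s \<in> paths T X"
      and neg: "gain T (\<lambda>i u. fst z (i, u)) s + (\<Sum>j<e. snd z j * g j s) < 0"
      using no_arbitrage[OF strategy_restrict_in_strategies[of T X "\<lambda>i u. fst z (i, u)"], of "snd z"]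
      by (auto simp: gain_strategy_restrict)
    obtain m where "1 / real (Suc m) < - (gain T (\<lambda>i u. fst z (i, u)) s + (\<Sum>j<e. snd z j * g j s))"
      using neg nat_approx_posE[of "- (gain T (\<lambda>i u. fst z (i, u)) s + (\<Sum>j<e. snd z j * g j s))"] by auto
    moreover have "- (1 / real (Suc m)) \<le> gain T (\<lambda>i u. fst z (i, u)) s + (\<Sum>j<e. snd z j * g j s)"
      using z[of m] s unfolding C_def by blast
    ultimately show False by linarith
  qed
  then obtain m where m: "\<And>H h. (\<Sum>j<e. \<bar>h j\<bar>) = 1 \<Longrightarrow>
    \<not> (\<forall>s\<in>paths T X. - (1 / real (Suc m)) \<le> gain T H s + (\<Sum>j<e. h j * g j s))"
    by blast
  have "coercive T X e g (1 / real (Suc m))"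
    unfolding coercive_def
  proof (intro conjI allI impI)
    fix H h x
    assume hedge: "\<forall>s\<in>paths T X. - x \<le> gain T H s + (\<Sum>j<e. h j * g j s)"
    \<comment> \<open>A general static position is divided by its size \<open>N\<close> to reach the
      normalised case. For \<open>N = 0\<close> the constant path, on which trading gains nothing,
      gives \<open>0 \<le> x\<close>.\<close>
    define N where "N = (\<Sum>j<e. \<bar>h j\<bar>)"
    show "1 / real (Suc m) * (\<Sum>j<e. \<bar>h j\<bar>) \<le> x"
    proof (cases "N = 0")
      case True
      then have "\<forall>j<e. h j = 0"
        by (auto simp: N_def sum_nonneg_eq_0_iff)
      then show ?thesis
        using hedge const_path gain_const_path[of H] by fastforce
    next
      case False
      then have N: "0 < N"
        unfolding N_def by (simp add: less_le sum_nonneg)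
      have "(\<Sum>j<e. \<bar>h j / N\<bar>) = 1"
        using N by (simp add: abs_divide N_def flip: sum_divide_distrib)
      then obtain s where s: "s \<in> paths T X"
        and "\<not> - (1 / real (Suc m)) \<le> gain T (\<lambda>i u. 1 / N * H i u) s + (\<Sum>j<e. h j / N * g j s)"
        using m[of "\<lambda>j. h j / N" "\<lambda>i u. 1 / N * H i u"] by blast
      moreover have "gain T (\<lambda>i u. 1 / N * H i u) s + (\<Sum>j<e. h j / N * g j s)
          = (gain T H s + (\<Sum>j<e. h j * g j s)) / N"
        unfolding gain_scale by (simp add: add_divide_distrib sum_divide_distrib)
      moreover have "- x / N \<le> (gain T H s + (\<Sum>j<e. h j * g j s)) / N"
        using hedge s N by (intro divide_right_mono) auto
      ultimately have "1 / real (Suc m) < x / N"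
        by simp
      then show ?thesis
        using N by (simp add: N_def[symmetric] field_simps)
    qed
  qed simp
  then show ?thesis by blast
qed

section \<open>Transfer of hedges between markets\<close>

text \<open>A strategy of the coarse market becomes one of the fine market by reacting to rounded
  prices; it stays nonanticipating because rounding acts on each time separately.\<close>

definition pull_strategy :: "(real \<Rightarrow> real) \<Rightarrow> (nat \<Rightarrow> path \<Rightarrow> real) \<Rightarrow> nat \<Rightarrow> path \<Rightarrow> real" where
  "pull_strategy r H = (\<lambda>i u. H i (\<lambda>j\<in>{1..i}. r (u j)))"

definition round_path :: "nat \<Rightarrow> (real \<Rightarrow> real) \<Rightarrow> path \<Rightarrow> path" where
  "round_path T r s = (\<lambda>i\<in>{0..T}. r (s i))"

lemma pull_strategy_restrict:
  assumes "i \<le> T"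
  shows "pull_strategy r H i (restrict s {1..i}) = H i (restrict (round_path T r s) {1..i})"
proof -
  have "(\<lambda>j\<in>{1..i}. r (restrict s {1..i} j)) = restrict (round_path T r s) {1..i}"
    using assms by (auto simp: round_path_def restrict_def)
  then show ?thesis
    by (simp add: pull_strategy_def)
qed

lemma round_path_in:
  assumes "\<And>i y. i \<le> T \<Longrightarrow> y \<in> X i \<Longrightarrow> r y \<in> Y i" "s \<in> paths T X"
  shows "round_path T r s \<in> paths T Y"
  using assms by (auto simp: paths_def PiE_iff round_path_def)

text \<open>Both gains use the same positions. Only the increments differ, each by at most
  \<open>2 * \<eta>\<close>.\<close>

lemma gain_pull_strategy:
  assumes r: "\<And>i. i \<le> T \<Longrightarrow> \<bar>r (s i) - s i\<bar> \<le> \<eta>"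
    and R: "\<And>t. t < T \<Longrightarrow> \<bar>H t (restrict (round_path T r s) {1..t})\<bar> \<le> R"
  shows "\<bar>gain T (pull_strategy r H) s - gain T H (round_path T r s)\<bar> \<le> real T * (R * (2 * \<eta>))"
proof -
  let ?s = "round_path T r s"
  have diff: "gain T (pull_strategy r H) s - gain T H ?s
      = (\<Sum>i<T. H i (restrict ?s {1..i}) * ((s (Suc i) - s i) - (?s (Suc i) - ?s i)))"
  proof -
    have "gain T (pull_strategy r H) s = (\<Sum>i<T. H i (restrict ?s {1..i}) * (s (Suc i) - s i))"
      unfolding gain_def by (intro sum.cong refl, subst pull_strategy_restrict[of _ T]) auto
    then show ?thesis
      by (simp only: gain_def right_diff_distrib sum_subtractf)
  qed
  have "\<bar>\<Sum>i<T. H i (restrict ?s {1..i}) * ((s (Suc i) - s i) - (?s (Suc i) - ?s i))\<bar>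
      \<le> (\<Sum>i<T. \<bar>H i (restrict ?s {1..i}) * ((s (Suc i) - s i) - (?s (Suc i) - ?s i))\<bar>)"
    by (rule sum_abs)
  also have "\<dots> \<le> (\<Sum>i<T. R * (2 * \<eta>))"
  proof (intro sum_mono)
    fix i assume "i \<in> {..<T}"
    then have i: "i < T" by simp
    have "?s i = r (s i)" "?s (Suc i) = r (s (Suc i))"
      using i by (simp_all add: round_path_def)
    then have "\<bar>(s (Suc i) - s i) - (?s (Suc i) - ?s i)\<bar> \<le> 2 * \<eta>"
      using r[of i] r[of "Suc i"] i by linarith
    moreover have "0 \<le> R"
      using R[OF i] by linarith
    ultimately show "\<bar>H i (restrict ?s {1..i}) * ((s (Suc i) - s i) - (?s (Suc i) - ?s i))\<bar> \<le> R * (2 * \<eta>)"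
      unfolding abs_mult by (intro mult_mono R[OF i] abs_ge_zero)
  qed
  finally show ?thesis
    unfolding diff by simp
qed


section \<open>A priori bounds on prices and the comparison of two markets\<close>

lemma (in market) price_le_payoff_bound:
  assumes "\<And>k s. k \<le> T \<Longrightarrow> s \<in> paths T X \<Longrightarrow> \<bar>\<Phi> k s\<bar> \<le> M"
  shows "superhedging_price T X e f \<Phi> \<le> ereal M"
proof -
  \<comment> \<open>Holding \<open>M\<close> in cash without any trading is a hedge.\<close>
  have "dated_hedge T X (\<lambda>k s. \<Phi> k s - M - (\<Sum>j<e. 0 * f j s)) (\<lambda>k t u. 0)"
    using assms by (auto simp: dated_hedge_def gain_def abs_le_iff)
  then have "M \<in> {x. \<exists>H h. dated_hedge T X (\<lambda>k s. \<Phi> k s - x - (\<Sum>j<e. h j * f j s)) H}"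
    by (intro CollectI exI)
  then show ?thesis
    unfolding superhedging_price_dated by (intro Inf_lower imageI)
qed

text \<open>The payoff at date \<open>T\<close> is at least \<open>- M\<close>, so the part of the
  hedge for date \<open>T\<close> shows that cash \<open>M + x\<close> finances the static position
  \<open>h\<close>.\<close>

lemma hedge_cost_coercive:
  assumes coercive: "coercive T X e f \<delta>"
    and H: "dated_hedge T X (\<lambda>k s. \<Phi> k s - x - (\<Sum>j<e. h j * f j s)) H"
    and M: "\<And>k s. k \<le> T \<Longrightarrow> s \<in> paths T X \<Longrightarrow> \<bar>\<Phi> k s\<bar> \<le> M"
  shows "\<delta> * (\<Sum>j<e. \<bar>h j\<bar>) \<le> M + x"
proof (rule coerciveD[OF coercive])
  fix s assume s: "s \<in> paths T X"
  show "- (M + x) \<le> gain T (H T) s + (\<Sum>j<e. h j * f j s)"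
    using dated_hedgeD[OF H order_refl s] M[OF order_refl s] by linarith
qed

lemma (in market) price_ge_payoff_bound:
  assumes coercive: "coercive T X e f \<delta>"
    and M: "\<And>k s. k \<le> T \<Longrightarrow> s \<in> paths T X \<Longrightarrow> \<bar>\<Phi> k s\<bar> \<le> M"
  shows "ereal (- M) \<le> superhedging_price T X e f \<Phi>"
  unfolding superhedging_price_dated
proof (intro Inf_greatest, clarsimp)
  fix x H and h :: "nat \<Rightarrow> real"
  assume "dated_hedge T X (\<lambda>k s. \<Phi> k s - x - (\<Sum>j<e. h j * f j s)) H"
  then have "\<delta> * (\<Sum>j<e. \<bar>h j\<bar>) \<le> M + x"
    by (rule hedge_cost_coercive[OF coercive _ M])
  moreover have "0 \<le> \<delta> * (\<Sum>j<e. \<bar>h j\<bar>)"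
    using coercive by (simp add: coercive_def sum_nonneg)
  ultimately show "- M \<le> x" by linarith
qed

lemma le_Inf_ereal_add:
  assumes "\<And>x. x \<in> S \<Longrightarrow> p \<le> ereal (x + C)"
  shows "p \<le> Inf (ereal ` S) + ereal C"
proof -
  have "p - ereal C \<le> Inf (ereal ` S)"
    using assms by (intro Inf_greatest) (auto simp: ereal_minus_le_iff add.commute)
  then show ?thesis
    by (simp add: ereal_minus_le_iff add.commute)
qed

text \<open>It suffices to compare hedges of cost below \<open>M\<close>, as \<open>M\<close> bounds both prices; the static
  part of such a hedge is bounded by coercivity.\<close>

lemma price_le_price_add:
  assumes X: "market T X d B" and Y: "market T Y d' B'"
    and coercive: "coercive T X e f \<delta>"
    and M: "\<And>k s. k \<le> T \<Longrightarrow> s \<in> paths T X \<Longrightarrow> \<bar>\<Phi> k s\<bar> \<le> M"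
    and M': "\<And>k s. k \<le> T \<Longrightarrow> s \<in> paths T Y \<Longrightarrow> \<bar>\<Phi> k s\<bar> \<le> M"
    and C: "0 \<le> C"
    and transfer: "\<And>x h H. dated_hedge T X (\<lambda>k s. \<Phi> k s - x - (\<Sum>j<e. h j * f j s)) H \<Longrightarrow> x < M \<Longrightarrow>
      (\<Sum>j<e. \<bar>h j\<bar>) \<le> 2 * M / \<delta> \<Longrightarrow>
      \<exists>H. dated_hedge T Y (\<lambda>k s. \<Phi> k s - (x + C) - (\<Sum>j<e. h j * f' j s)) H"
  shows "superhedging_price T Y e f' \<Phi> \<le> superhedging_price T X e f \<Phi> + ereal C"
proof -
  interpret X: market T X d B by (rule X)
  interpret Y: market T Y d' B' by (rule Y)
  have "superhedging_price T Y e f' \<Phi> \<le> ereal (x + C)"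
    if H: "dated_hedge T X (\<lambda>k s. \<Phi> k s - x - (\<Sum>j<e. h j * f j s)) H" for x H h
  proof (cases "x < M")
    case False
    then have "ereal M \<le> ereal (x + C)"
      using C by simp
    with Y.price_le_payoff_bound[OF M'] show ?thesis
      by (rule order_trans)
  next
    case True
    have "\<delta> * (\<Sum>j<e. \<bar>h j\<bar>) \<le> M + x"
      by (rule hedge_cost_coercive[OF coercive H M])
    then have "(\<Sum>j<e. \<bar>h j\<bar>) \<le> 2 * M / \<delta>"
      using True coercive by (simp add: coercive_def field_simps)
    from transfer[OF H True this] show ?thesis
      unfolding Y.superhedging_price_dated by (intro Inf_lower imageI) blast
  qed
  then show ?thesis
    unfolding X.superhedging_price_dated by (intro le_Inf_ereal_add) blast
qed

text \<open>\<open>Y\<close> is a coarser submarket reached from \<open>X\<close> by the rounding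
  \<open>r\<close>. The parameter \<open>w\<close> bounds the effect of rounding on payoffs,
  \<open>q\<close> the option prices, \<open>G\<close> and \<open>M\<close> the payoffs
  themselves.\<close>

locale rounded_market = X: market T X d B + Y: market T Y d B
  for T X Y d B +
  fixes e :: nat and g \<Phi> :: "nat \<Rightarrow> path \<Rightarrow> real" and c :: "nat \<Rightarrow> real"
    and r :: "real \<Rightarrow> real" and \<eta> w q G M :: real
  assumes sub: "i \<le> T \<Longrightarrow> Y i \<subseteq> X i"
    and round_in: "i \<le> T \<Longrightarrow> y \<in> X i \<Longrightarrow> r y \<in> Y i"
    and round_error: "\<bar>r y - y\<bar> \<le> \<eta>"
    and g_round: "j < e \<Longrightarrow> s \<in> paths T X \<Longrightarrow> \<bar>g j s - g j (round_path T r s)\<bar> \<le> w"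
    and \<Phi>_round: "k \<le> T \<Longrightarrow> s \<in> paths T X \<Longrightarrow> \<bar>\<Phi> k s - \<Phi> k (round_path T r s)\<bar> \<le> w"
    and g_bound: "j < e \<Longrightarrow> s \<in> paths T X \<Longrightarrow> \<bar>g j s\<bar> \<le> G"
    and \<Phi>_bound: "k \<le> T \<Longrightarrow> s \<in> paths T X \<Longrightarrow> \<bar>\<Phi> k s\<bar> \<le> M"
    and c_bound: "j < e \<Longrightarrow> \<bar>c j\<bar> \<le> q"
    and G_nonneg: "0 \<le> G" and q_nonneg: "0 \<le> q"
begin

lemma w_nonneg: "0 \<le> w"
  using \<Phi>_round[OF order_refl X.const_path] by linarith

lemma M_nonneg: "0 \<le> M"
  using \<Phi>_bound[OF order_refl X.const_path] by linarith

lemma \<eta>_nonneg: "0 \<le> \<eta>"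
  using round_error[of 0] by linarith

lemma paths_sub: "s \<in> paths T Y \<Longrightarrow> s \<in> paths T X"
  using sub by (fastforce simp: paths_def PiE_iff)

lemma round_path_paths: "s \<in> paths T X \<Longrightarrow> round_path T r s \<in> paths T Y"
  by (rule round_path_in[where X = X]) (rule round_in)

lemma net_payoff_bound: "j < e \<Longrightarrow> s \<in> paths T Y \<Longrightarrow> \<bar>g j s - c j\<bar> \<le> G + q"
  using g_bound[of j s] c_bound[of j] paths_sub by fastforce

text \<open>Sharing \<open>d\<close> and \<open>B\<close>, the two markets have the same position
  constant, so \<open>X.A\<close> bounds positions on \<open>Y\<close> as well.\<close>

lemma pulled_gain:
  assumes "\<And>s. s \<in> paths T Y \<Longrightarrow> - K \<le> gain T H s" "s \<in> paths T X"
  shows "\<bar>gain T (pull_strategy r H) s - gain T H (round_path T r s)\<bar> \<le> real T * (X.A * K * (2 * \<eta>))"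
  using assms by (intro gain_pull_strategy round_error Y.position_bound round_path_paths)

lemma static_round:
  assumes "s \<in> paths T X"
  shows "\<bar>(\<Sum>j<e. h j * (g j (round_path T r s) - c j)) - (\<Sum>j<e. h j * g j s)\<bar>
    \<le> (\<Sum>j<e. \<bar>h j\<bar>) * (w + q)"
proof -
  have "(\<Sum>j<e. h j * (g j (round_path T r s) - c j)) - (\<Sum>j<e. h j * g j s)
      = (\<Sum>j<e. h j * (g j (round_path T r s) - c j - g j s))"
    unfolding sum_subtractf[symmetric] by (simp add: algebra_simps)
  moreover have "\<bar>g j (round_path T r s) - c j - g j s\<bar> \<le> w + q" if "j < e" for j
    using g_round[OF that assms] c_bound[OF that] by linarith
  ultimately show ?thesis
    using abs_sum_mult_le[of "{..<e}" "\<lambda>j. g j (round_path T r s) - c j - g j s" "w + q" h] by simp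
qed

text \<open>A position financed on \<open>Y\<close> is pulled back to \<open>X\<close>, where
  coercivity is known. The rounding loss is linear in the size of \<open>h\<close>, since the
  positions are too, and so only lowers the constant.\<close>

lemma coercive_coarse:
  assumes coercive: "coercive T X e g \<delta>"
    and small: "w + q + 2 * real T * X.A * (\<delta> + G + q) * \<eta> < \<delta>"
  shows "coercive T Y e (\<lambda>j s. g j s - c j) (\<delta> - (w + q + 2 * real T * X.A * (\<delta> + G + q) * \<eta>))"
    (is "coercive T Y e _ (\<delta> - ?\<epsilon>)")
  unfolding coercive_def
proof (intro conjI allI impI)
  show "0 < \<delta> - ?\<epsilon>" using small by simp
  fix H h x
  assume hedge: "\<forall>s\<in>paths T Y. - x \<le> gain T H s + (\<Sum>j<e. h j * (g j s - c j))"
  define N where "N = (\<Sum>j<e. \<bar>h j\<bar>)"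
  have N: "0 \<le> N" unfolding N_def by (simp add: sum_nonneg)
  \<comment> \<open>The loss bound for trading when \<open>x < \<delta> * N\<close>: cash
    contributes at most \<open>\<delta> * N\<close> and the static payoff at most
    \<open>N * (G + q)\<close>. For larger \<open>x\<close> the claim is immediate.\<close>
  define K where "K = N * (\<delta> + G + q)"
  have "\<delta> * N \<le> x + N * ?\<epsilon>"
  proof (cases "x < \<delta> * N")
    case True
    have K: "- K \<le> gain T H s" if "s \<in> paths T Y" for s
    proof -
      have "\<bar>\<Sum>j<e. h j * (g j s - c j)\<bar> \<le> N * (G + q)"
        unfolding N_def using net_payoff_bound that by (intro abs_sum_mult_le) auto
      moreover have "- x \<le> gain T H s + (\<Sum>j<e. h j * (g j s - c j))"
        using hedge that by blast
      ultimately show ?thesis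
        using True unfolding K_def by (simp add: algebra_simps)
    qed
    show ?thesis
      unfolding N_def
    proof (rule coerciveD[OF coercive])
      fix s assume s: "s \<in> paths T X"
      have "- x \<le> gain T H (round_path T r s) + (\<Sum>j<e. h j * (g j (round_path T r s) - c j))"
        using hedge round_path_paths[OF s] by blast
      moreover have "N * ?\<epsilon> = N * (w + q) + real T * (X.A * K * (2 * \<eta>))"
        by (simp add: K_def algebra_simps)
      ultimately show "- (x + (\<Sum>j<e. \<bar>h j\<bar>) * ?\<epsilon>) \<le> gain T (pull_strategy r H) s + (\<Sum>j<e. h j * g j s)"
        using pulled_gain[OF K s] static_round[OF s, of h] unfolding N_def[symmetric] by linarith
    qed
  next
    case False
    moreover have "0 \<le> ?\<epsilon>"
      using w_nonneg q_nonneg G_nonneg \<eta>_nonneg X.A_nonneg coercive by (simp add: coercive_def)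
    then have "0 \<le> N * ?\<epsilon>"
      using N by simp
    ultimately show ?thesis by linarith
  qed
  then show "(\<delta> - ?\<epsilon>) * (\<Sum>j<e. \<bar>h j\<bar>) \<le> x"
    unfolding N_def[symmetric] by (simp add: algebra_simps)
qed

text \<open>A hedge on \<open>X\<close> also works on the subset of paths \<open>Y\<close> without
  rounding. Extra cash is needed only for the prices \<open>c\<close> of the static
  position.\<close>

lemma coarse_price_le:
  assumes "coercive T X e g \<delta>"
  shows "superhedging_price T Y e (\<lambda>j s. g j s - c j) \<Phi> \<le>
    superhedging_price T X e g \<Phi> + ereal (2 * M / \<delta> * q)"
proof (rule price_le_price_add[OF X.market_axioms Y.market_axioms assms])
  show "0 \<le> 2 * M / \<delta> * q"
    using M_nonneg q_nonneg assms by (simp add: coercive_def)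
  fix x H and h :: "nat \<Rightarrow> real"
  assume H: "dated_hedge T X (\<lambda>k s. \<Phi> k s - x - (\<Sum>j<e. h j * g j s)) H"
    and h: "(\<Sum>j<e. \<bar>h j\<bar>) \<le> 2 * M / \<delta>"
  have "\<bar>\<Sum>j<e. h j * c j\<bar> \<le> (\<Sum>j<e. \<bar>h j\<bar>) * q"
    using c_bound by (intro abs_sum_mult_le) auto
  also have "\<dots> \<le> 2 * M / \<delta> * q"
    using h q_nonneg by (rule mult_right_mono)
  finally have "\<Phi> k s - (x + 2 * M / \<delta> * q) - (\<Sum>j<e. h j * (g j s - c j)) \<le> \<Phi> k s - x - (\<Sum>j<e. h j * g j s)" for k s
    by (simp add: right_diff_distrib sum_subtractf)
  then have "dated_hedge T Y (\<lambda>k s. \<Phi> k s - (x + 2 * M / \<delta> * q) - (\<Sum>j<e. h j * (g j s - c j))) H"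
    using H paths_sub unfolding dated_hedge_def by (meson order_trans)
  then show "\<exists>H. dated_hedge T Y (\<lambda>k s. \<Phi> k s - (x + 2 * M / \<delta> * q) - (\<Sum>j<e. h j * (g j s - c j))) H"
    by blast
qed (use \<Phi>_bound paths_sub in auto)

text \<open>The hedge on \<open>Y\<close> is played along rounded prices. The three summands of
  \<open>C\<close> pay for rounding the American payoff, for the static position with its price, and
  for trading at unrounded increments.\<close>

lemma fine_price_le:
  assumes coercive: "coercive T Y e (\<lambda>j s. g j s - c j) \<delta>"
  defines "C \<equiv> w + 2 * M / \<delta> * (w + q) + real T * (X.A * (2 * M + 2 * M / \<delta> * (G + q)) * (2 * \<eta>))"
  shows "superhedging_price T X e g \<Phi> \<le>
    superhedging_price T Y e (\<lambda>j s. g j s - c j) \<Phi> + ereal C"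
proof (rule price_le_price_add[OF Y.market_axioms X.market_axioms coercive])
  have \<delta>: "0 < \<delta>" using coercive by (simp add: coercive_def)
  show "0 \<le> C"
    unfolding C_def
    using w_nonneg q_nonneg G_nonneg \<eta>_nonneg M_nonneg X.A_nonneg \<delta>
    by (intro add_nonneg_nonneg mult_nonneg_nonneg divide_nonneg_pos) auto
  fix x H and h :: "nat \<Rightarrow> real"
  assume H: "dated_hedge T Y (\<lambda>k s. \<Phi> k s - x - (\<Sum>j<e. h j * (g j s - c j))) H"
    and x: "x < M" and h: "(\<Sum>j<e. \<bar>h j\<bar>) \<le> 2 * M / \<delta>"
  \<comment> \<open>The hedging inequality bounds the trading loss: \<open>2 * M\<close> covers the
    payoff and the cost \<open>x < M\<close>, the rest covers the static part.\<close>
  define K where "K = 2 * M + 2 * M / \<delta> * (G + q)"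
  have K: "- K \<le> gain T (H k) s" if "k \<le> T" "s \<in> paths T Y" for k s
  proof -
    have "\<bar>\<Sum>j<e. h j * (g j s - c j)\<bar> \<le> (\<Sum>j<e. \<bar>h j\<bar>) * (G + q)"
      using net_payoff_bound that by (intro abs_sum_mult_le) auto
    also have "\<dots> \<le> 2 * M / \<delta> * (G + q)"
      using h G_nonneg q_nonneg by (intro mult_right_mono) auto
    finally show ?thesis
      using dated_hedgeD[OF H that] \<Phi>_bound[OF that(1) paths_sub[OF that(2)]] x unfolding K_def by linarith
  qed
  have "dated_hedge T X (\<lambda>k s. \<Phi> k s - (x + C) - (\<Sum>j<e. h j * g j s)) (\<lambda>k. pull_strategy r (H k))"
    unfolding dated_hedge_def
  proof (intro conjI allI ballI impI)
    fix k l t s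
    assume "k \<le> T" "l \<le> T" "t < min k l" "s \<in> paths T X"
    then show "pull_strategy r (H k) t (restrict s {1..t}) = pull_strategy r (H l) t (restrict s {1..t})"
      using dated_hedge_before[OF H _ _ _ round_path_paths, of k l t s]
      by (simp add: pull_strategy_restrict[of _ T] del: One_nat_def)
  next
    fix k s assume k: "k \<le> T" and s: "s \<in> paths T X"
    have "(\<Sum>j<e. \<bar>h j\<bar>) * (w + q) \<le> 2 * M / \<delta> * (w + q)"
      using h w_nonneg q_nonneg by (intro mult_right_mono) auto
    then show "\<Phi> k s - (x + C) - (\<Sum>j<e. h j * g j s) \<le> gain T (pull_strategy r (H k)) s"
      using dated_hedgeD[OF H k round_path_paths[OF s]] pulled_gain[OF K[OF k] s] static_round[OF s, of h]
        \<Phi>_round[OF k s] unfolding C_def K_def[symmetric] by linarith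
  qed
  then show "\<exists>H. dated_hedge T X (\<lambda>k s. \<Phi> k s - (x + C) - (\<Sum>j<e. h j * g j s)) H"
    by blast
qed (use \<Phi>_bound paths_sub in auto)

end


section \<open>Rounding to the dyadic grid\<close>

definition round_down :: "nat \<Rightarrow> real \<Rightarrow> real" where
  "round_down n y = real_of_int \<lfloor>y * 2 ^ n\<rfloor> / 2 ^ n"

lemma round_down_le: "round_down n y \<le> y"
  by (simp add: round_down_def field_simps)

lemma round_down_error: "\<bar>round_down n y - y\<bar> \<le> 1 / 2 ^ n"
proof -
  have "y * 2 ^ n \<le> real_of_int \<lfloor>y * 2 ^ n\<rfloor> + 1"
    by (rule real_of_int_floor_add_one_ge)
  then have "y \<le> round_down n y + 1 / 2 ^ n"
    by (simp add: round_down_def field_simps)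
  then show ?thesis
    using round_down_le[of n y] by linarith
qed

lemma round_down_ge:
  assumes "x \<in> grid n" "x \<le> y"
  shows "x \<le> round_down n y"
proof -
  obtain k :: nat where k: "x = real k / 2 ^ n"
    using assms(1) by (auto simp: grid_def)
  then have "int k \<le> \<lfloor>y * 2 ^ n\<rfloor>"
    using mult_right_mono[OF assms(2), of "2 ^ n"] by (simp add: le_floor_iff)
  then have "real k \<le> real_of_int \<lfloor>y * 2 ^ n\<rfloor>"
    by linarith
  then show ?thesis
    by (simp add: k round_down_def divide_right_mono)
qed

lemma round_down_in_grid:
  assumes "0 \<le> y"
  shows "round_down n y \<in> grid n"
proof -
  have "round_down n y = real (nat \<lfloor>y * 2 ^ n\<rfloor>) / 2 ^ n"
    using assms by (simp add: round_down_def)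
  then show ?thesis
    unfolding grid_def by (rule range_eqI)
qed

lemma one_in_grid: "1 \<in> grid n"
  unfolding grid_def by (rule range_eqI[of _ _ "2 ^ n"]) simp

lemma grid_mono:
  assumes "m \<le> n"
  shows "grid m \<subseteq> grid n"
proof
  fix x assume "x \<in> grid m"
  then obtain k :: nat where "x = real k / 2 ^ m"
    by (auto simp: grid_def)
  also have "\<dots> = real (k * 2 ^ (n - m)) / 2 ^ n"
    using assms by (simp add: field_simps flip: power_add)
  finally show "x \<in> grid n"
    unfolding grid_def by (rule range_eqI)
qed

lemma eventually_in_grid:
  assumes "x \<in> dyadic"
  shows "\<forall>\<^sub>F n in sequentially. x \<in> grid n"
proof -
  obtain m where "x \<in> grid m"
    using assms by (auto simp: dyadic_def)
  then show ?thesis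
    using grid_mono by (auto simp: eventually_sequentially)
qed

text \<open>Rounding down cannot cross the lower endpoint, which is a grid point, and never crosses
  the upper one. The initial price 1 is on every grid and stays fixed.\<close>

lemma round_down_price_range:
  assumes grid: "i \<noteq> 0 \<Longrightarrow> a i \<in> grid n" and "i \<noteq> 0 \<Longrightarrow> 0 \<le> a i"
    and y: "y \<in> price_range a b i"
  shows "round_down n y \<in> grid_price_range a b n i"
proof (cases "i = 0")
  case True
  then have "round_down n y = 1"
    using y round_down_le[of n 1] round_down_ge[OF one_in_grid, of 1 n] by (simp add: price_range_def)
  then show ?thesis
    using True one_in_grid by (simp add: grid_price_range_def price_range_def)
next
  case False
  then have "a i \<le> y" "y \<le> b i" "0 \<le> y"
    using y assms(2) by (auto simp: price_range_def)
  then show ?thesis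
    using False round_down_in_grid[of y n] round_down_ge[OF grid, of y] round_down_le[of n y]
    by (simp add: grid_price_range_def price_range_def)
qed

lemma finite_positive_lower_bound:
  fixes m :: "'i \<Rightarrow> real"
  assumes "finite I" "\<And>i. i \<in> I \<Longrightarrow> 0 < m i"
  shows "\<exists>d>0. \<forall>i\<in>I. d \<le> m i"
  using assms by (intro exI[of _ "Min (insert 1 (m ` I))"]) auto

text \<open>The set \<open>\<Gamma>\<close> is either all reals or a grid; choosing \<open>d\<close>
  and \<open>B\<close> before \<open>\<Gamma>\<close> makes the constants uniform over all
  discretizations.\<close>

lemma market_price_range:
  assumes bounds: "\<forall>i\<in>{1..T}. 0 \<le> a i \<and> a i < 1 \<and> 1 < b i"
    and a_decreasing: "\<forall>i\<in>{1..T}. \<forall>j\<in>{1..T}. i < j \<longrightarrow> a j < a i"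
    and b_increasing: "\<forall>i\<in>{1..T}. \<forall>j\<in>{1..T}. i < j \<longrightarrow> b i < b j"
  shows "\<exists>d B. \<forall>\<Gamma>. 1 \<in> \<Gamma> \<longrightarrow> (\<forall>i\<in>{1..T}. a i \<in> \<Gamma> \<and> b i \<in> \<Gamma>) \<longrightarrow>
    market T (\<lambda>i. price_range a b i \<inter> \<Gamma>) d B"
proof -
  \<comment> \<open>Setting both endpoints to 1 at time 0 includes the first step in the strict
    widening of the ranges.\<close>
  define lo hi where "lo t = (if t = 0 then 1 else a t)" and "hi t = (if t = 0 then 1 else b t)" for t :: nat
  have range: "price_range a b t = {lo t..hi t}" for t
    by (simp add: price_range_def lo_def hi_def)
  have lo: "lo j < lo i" and hi: "hi i < hi j" if "i < j" "j \<le> T" for i j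
    using that bounds a_decreasing b_increasing by (auto simp: lo_def hi_def)
  have lo_le: "lo j \<le> lo i" and hi_le: "hi i \<le> hi j" if "i \<le> j" "j \<le> T" for i j
    using lo[of i j] hi[of i j] that by (cases "i = j"; simp)+
  have lo_nonneg: "0 \<le> lo t" if "t \<le> T" for t
    using bounds that by (auto simp: lo_def)
  have lo_hi: "lo t \<le> hi t" if "t \<le> T" for t
  proof (cases "t = 0")
    case False
    then have "a t < 1 \<and> 1 < b t" using bounds that by simp
    with False show ?thesis by (simp add: lo_def hi_def)
  qed (simp add: lo_def hi_def)
  \<comment> \<open>The smallest widening on either side. The next endpoints then realise moves of
    size at least \<open>d\<close>, and they lie in \<open>\<Gamma>\<close>.\<close>
  obtain d where d: "0 < d" "\<And>t. t < T \<Longrightarrow> d \<le> min (lo t - lo (Suc t)) (hi (Suc t) - hi t)"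
    using finite_positive_lower_bound[of "{..<T}" "\<lambda>t. min (lo t - lo (Suc t)) (hi (Suc t) - hi t)"] lo hi
    by auto
  have "market T (\<lambda>i. price_range a b i \<inter> \<Gamma>) d (hi T)"
    if one: "1 \<in> \<Gamma>" and endpoints: "\<forall>i\<in>{1..T}. a i \<in> \<Gamma> \<and> b i \<in> \<Gamma>" for \<Gamma>
  proof
    show "0 < d" by (rule d)
    show "0 \<le> hi T"
      using lo_nonneg[of T] lo_hi[of T] by simp
    show "price_range a b 0 \<inter> \<Gamma> = {1}"
      using one by (simp add: price_range_def)
    show "price_range a b i \<inter> \<Gamma> \<subseteq> price_range a b j \<inter> \<Gamma>" if "i \<le> j" "j \<le> T" for i j
      using lo_le[OF that] hi_le[OF that] by (auto simp: range)
    fix t y assume t: "t < T" and y: "y \<in> price_range a b t \<inter> \<Gamma>"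
    have "lo (Suc t) \<in> \<Gamma>" "hi (Suc t) \<in> \<Gamma>"
      using endpoints t by (auto simp: lo_def hi_def)
    then have "lo (Suc t) \<in> price_range a b (Suc t) \<inter> \<Gamma>" "hi (Suc t) \<in> price_range a b (Suc t) \<inter> \<Gamma>"
      using lo_hi[of "Suc t"] t by (auto simp: range)
    moreover have "lo (Suc t) \<le> y - d" "y + d \<le> hi (Suc t)"
      using y d(2)[OF t] by (auto simp: range)
    ultimately show "\<exists>v\<in>price_range a b (Suc t) \<inter> \<Gamma>. v \<le> y - d"
      "\<exists>v\<in>price_range a b (Suc t) \<inter> \<Gamma>. y + d \<le> v"
      by blast+
    fix z assume "z \<in> price_range a b (Suc t) \<inter> \<Gamma>"
    then show "\<bar>z - y\<bar> \<le> hi T"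
      using y t hi_le[of t T] hi_le[of "Suc t" T] lo_nonneg[of t] lo_nonneg[of "Suc t"] by (auto simp: range)
  qed
  then show ?thesis by blast
qed

text \<open>A common form for the continuous and the Lipschitz case. The bound is only eventual: on
  a coarse grid that misses an endpoint, rounding may leave the price range.\<close>

definition rounding_modulus ::
  "nat \<Rightarrow> (nat \<Rightarrow> real set) \<Rightarrow> (path \<Rightarrow> real) \<Rightarrow> (nat \<Rightarrow> real) \<Rightarrow> bool" where
  "rounding_modulus T X f w \<longleftrightarrow> w \<longlonglongrightarrow> 0 \<and> (\<forall>n. 0 \<le> w n) \<and>
     (\<forall>\<^sub>F n in sequentially. \<forall>s\<in>paths T X. \<bar>f s - f (round_path T (round_down n) s)\<bar> \<le> w n)"

lemma inverse_power_two_tendsto: "(\<lambda>n. 1 / 2 ^ n :: real) \<longlonglongrightarrow> 0"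
  using LIMSEQ_power_zero[of "1 / 2 :: real"] by (simp add: power_divide)

text \<open>The sum of finitely many moduli serves all the functions at once.\<close>

lemma rounding_modulus_family:
  assumes "finite I" "\<And>i. i \<in> I \<Longrightarrow> rounding_modulus T X (f i) (w i)" "i \<in> I"
  shows "rounding_modulus T X (f i) (\<lambda>n. \<Sum>i\<in>I. w i n)"
proof -
  have le: "w i n \<le> (\<Sum>i\<in>I. w i n)" for n
    using assms by (intro member_le_sum) (auto simp: rounding_modulus_def)
  have "(\<lambda>n. \<Sum>i\<in>I. w i n) \<longlonglongrightarrow> 0"
    using assms(2) by (intro tendsto_null_sum) (simp add: rounding_modulus_def)
  moreover have "0 \<le> (\<Sum>i\<in>I. w i n)" for n
    using assms(2) by (intro sum_nonneg) (simp add: rounding_modulus_def)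
  moreover have "\<forall>\<^sub>F n in sequentially. \<forall>s\<in>paths T X. \<bar>f i s - f i (round_path T (round_down n) s)\<bar> \<le> w i n"
    using assms(2,3) by (simp add: rounding_modulus_def)
  then have "\<forall>\<^sub>F n in sequentially. \<forall>s\<in>paths T X.
      \<bar>f i s - f i (round_path T (round_down n) s)\<bar> \<le> (\<Sum>i\<in>I. w i n)"
    by (rule eventually_mono) (blast intro: order_trans[OF _ le])
  ultimately show ?thesis
    by (simp add: rounding_modulus_def)
qed

lemma round_path_error:
  assumes "i \<le> T"
  shows "\<bar>s i - round_path T (round_down n) s i\<bar> \<le> 1 / 2 ^ n"
  using assms round_down_error[of n "s i"] by (simp add: round_path_def abs_minus_commute)

lemma lipschitz_rounding_modulus:
  assumes "lipschitz_paths T (paths T X) f"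
    and into: "\<forall>\<^sub>F n in sequentially. \<forall>s\<in>paths T X. round_path T (round_down n) s \<in> paths T X"
  shows "\<exists>L\<ge>0. rounding_modulus T X f (\<lambda>n. L * (1 / 2 ^ n))"
proof -
  obtain L where L: "\<And>s s'. s \<in> paths T X \<Longrightarrow> s' \<in> paths T X \<Longrightarrow>
      \<bar>f s - f s'\<bar> \<le> L * sup_norm (Suc T) (\<lambda>i. s i - s' i)"
    using assms(1) unfolding lipschitz_paths_def by blast
  have "\<bar>f s - f (round_path T (round_down n) s)\<bar> \<le> \<bar>L\<bar> * (1 / 2 ^ n)"
    if "s \<in> paths T X" "round_path T (round_down n) s \<in> paths T X" for s n
  proof -
    let ?N = "sup_norm (Suc T) (\<lambda>i. s i - round_path T (round_down n) s i)"
    have "0 \<le> ?N" "?N \<le> 1 / 2 ^ n"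
      using round_path_error[of _ T s n] by (auto simp: sup_norm_def less_Suc_eq_le)
    then have "L * ?N \<le> \<bar>L\<bar> * (1 / 2 ^ n)"
      by (intro mult_mono) auto
    then show ?thesis
      using L[OF that] by linarith
  qed
  then have "\<forall>\<^sub>F n in sequentially. \<forall>s\<in>paths T X.
      \<bar>f s - f (round_path T (round_down n) s)\<bar> \<le> \<bar>L\<bar> * (1 / 2 ^ n)"
    using into by (auto elim!: eventually_mono)
  moreover have "(\<lambda>n. \<bar>L\<bar> * (1 / 2 ^ n)) \<longlonglongrightarrow> 0"
    by (rule tendsto_mult_right_zero[OF inverse_power_two_tendsto])
  ultimately have "rounding_modulus T X f (\<lambda>n. \<bar>L\<bar> * (1 / 2 ^ n))"
    by (simp add: rounding_modulus_def)
  then show ?thesis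
    by (intro exI[of _ "\<bar>L\<bar>"]) simp
qed

text \<open>Twice the maximum over the first coordinates plus a tail \<open>(1 / 2) ^ N\<close>
  bounds the product metric; then \<open>N\<close> tends to infinity.\<close>

lemma dist_path_le:
  fixes s s' :: path
  assumes "\<And>i. \<bar>s i - s' i\<bar> \<le> \<epsilon>"
  shows "dist s s' \<le> 2 * \<epsilon>"
proof (rule LIMSEQ_le_const)
  show "(\<lambda>N. 2 * \<epsilon> + (1 / 2) ^ N) \<longlonglongrightarrow> 2 * \<epsilon>"
    using tendsto_add[OF tendsto_const[of "2 * \<epsilon>"] LIMSEQ_power_zero[of "1 / 2 :: real"]] by simp
  have "dist s s' \<le> 2 * \<epsilon> + (1 / 2) ^ N" for N
  proof -
    have "Max {dist (s (from_nat n)) (s' (from_nat n)) |n. n \<le> N} \<le> \<epsilon>"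
      using assms by (subst Max_le_iff) (auto simp: dist_real_def)
    then show ?thesis
      using dist_fun_le_dist_first_terms[of s s' N] by linarith
  qed
  then show "\<exists>N. \<forall>n\<ge>N. dist s s' \<le> 2 * \<epsilon> + (1 / 2) ^ n" by blast
qed

text \<open>Uniform continuity on the compact path space makes the largest rounding error tend to
  0.\<close>

lemma continuous_rounding_modulus:
  assumes compact: "compact (paths T X)" and nonempty: "paths T X \<noteq> {}"
    and f: "continuous_on (paths T X) f"
    and into: "\<forall>\<^sub>F n in sequentially. \<forall>s\<in>paths T X. round_path T (round_down n) s \<in> paths T X"
  shows "\<exists>w. rounding_modulus T X f w"
proof -
  let ?\<Omega> = "paths T X" and ?D = "\<lambda>n. round_path T (round_down n)"
  define w where "w n = (SUP s\<in>?\<Omega>. \<bar>f s - f (?D n s)\<bar>)" for n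
  obtain G where G: "\<And>s. s \<in> ?\<Omega> \<Longrightarrow> \<bar>f s\<bar> \<le> G"
    using compact_family_bounded[of "{()}" ?\<Omega> "\<lambda>_. f"] compact f by auto
  have bound: "\<bar>f s - f (?D n s)\<bar> \<le> w n"
    if "\<forall>s\<in>?\<Omega>. ?D n s \<in> ?\<Omega>" "s \<in> ?\<Omega>" for n s
    unfolding w_def
  proof (rule cSUP_upper[OF that(2)])
    have "\<bar>f s - f (?D n s)\<bar> \<le> G + G" if "s \<in> ?\<Omega>" for s
      using G[OF that] G[of "?D n s"] \<open>\<forall>s\<in>?\<Omega>. ?D n s \<in> ?\<Omega>\<close> that by fastforce
    then show "bdd_above ((\<lambda>s. \<bar>f s - f (?D n s)\<bar>) ` ?\<Omega>)"
      by (intro bdd_aboveI2)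
  qed
  \<comment> \<open>The absolute value ensures nonnegativity also for those \<open>n\<close> where
    rounding leaves the path space and the supremum is uncontrolled.\<close>
  have "(\<lambda>n. \<bar>w n\<bar>) \<longlonglongrightarrow> 0"
  proof (rule tendstoI)
    fix \<epsilon> :: real assume "0 < \<epsilon>"
    then obtain \<delta> where \<delta>: "0 < \<delta>"
      and uc: "\<And>s s'. s \<in> ?\<Omega> \<Longrightarrow> s' \<in> ?\<Omega> \<Longrightarrow> dist s' s < \<delta> \<Longrightarrow> dist (f s') (f s) < \<epsilon> / 2"
      using compact_uniformly_continuous[OF f compact] unfolding uniformly_continuous_on_def
      by (metis half_gt_zero)
    have "\<forall>\<^sub>F n in sequentially. 1 / 2 ^ n < \<delta> / 2"
      using order_tendstoD(2)[OF inverse_power_two_tendsto, of "\<delta> / 2"] \<delta> by simp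
    then show "\<forall>\<^sub>F n in sequentially. dist \<bar>w n\<bar> 0 < \<epsilon>"
      using into
    proof eventually_elim
      case (elim n)
      have "\<bar>f s - f (?D n s)\<bar> \<le> \<epsilon> / 2" if s: "s \<in> ?\<Omega>" for s
      proof -
        have "\<bar>s i - ?D n s i\<bar> \<le> 1 / 2 ^ n" for i
          using round_path_error[of i T s n] s
          by (cases "i \<le> T") (auto simp: round_path_def paths_def PiE_iff extensional_def)
        then have "dist s (?D n s) < \<delta>"
          using dist_path_le[of s "?D n s" "1 / 2 ^ n"] elim(1) by simp
        then show ?thesis
          using uc[of "?D n s" s] elim(2) s by (simp add: dist_real_def)
      qed
      then have "w n \<le> \<epsilon> / 2"
        unfolding w_def by (intro cSUP_least nonempty)
      moreover have "0 \<le> w n"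
        using bound[OF elim(2)] nonempty by (meson abs_ge_zero equals0I order_trans)
      ultimately show ?case
        using \<open>0 < \<epsilon>\<close> by simp
    qed
  qed
  moreover have "\<forall>\<^sub>F n in sequentially. \<forall>s\<in>?\<Omega>. \<bar>f s - f (?D n s)\<bar> \<le> \<bar>w n\<bar>"
    using into by eventually_elim (use bound in \<open>blast intro: order_trans[OF _ abs_ge_self]\<close>)
  ultimately have "rounding_modulus T X f (\<lambda>n. \<bar>w n\<bar>)"
    by (simp add: rounding_modulus_def)
  then show ?thesis by blast
qed


section \<open>The discretization error\<close>

lemma abs_le_sup_norm: "j < m \<Longrightarrow> \<bar>v j\<bar> \<le> sup_norm m v"
  by (auto simp: sup_norm_def)

lemma sup_norm_nonneg: "0 \<le> sup_norm m v"
  by (auto simp: sup_norm_def)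

lemma coercive_mono: "coercive T X e f \<delta> \<Longrightarrow> 0 < \<delta>' \<Longrightarrow> \<delta>' \<le> \<delta> \<Longrightarrow> coercive T X e f \<delta>'"
  unfolding coercive_def by (meson mult_right_mono order_trans sum_nonneg abs_ge_zero)

text \<open>The bounds make \<open>p\<close> finite and the two inequalities then make
  \<open>p'\<close> finite, which excludes a difference of infinities.\<close>

lemma abs_ereal_diff_le:
  fixes p p' :: ereal
  assumes "ereal l \<le> p" "p \<le> ereal u" "p \<le> p' + ereal C" "p' \<le> p + ereal C"
  shows "\<bar>p' - p\<bar> \<le> ereal C"
proof -
  obtain r where r: "p = ereal r"
    using assms(1,2) by (cases p) auto
  obtain r' where "p' = ereal r'"
    using assms(3,4) r by (cases p') auto
  then show ?thesis
    using assms(3,4) r by (simp add: abs_le_iff)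
qed

lemma tendsto_ereal_error:
  fixes f :: "nat \<Rightarrow> ereal"
  assumes "\<bar>p\<bar> \<noteq> \<infinity>" "\<forall>\<^sub>F n in sequentially. \<bar>f n - p\<bar> \<le> ereal (u n)" "u \<longlonglongrightarrow> 0"
  shows "f \<longlonglongrightarrow> p"
proof -
  obtain r where r: "p = ereal r"
    using assms(1) by (cases p) auto
  have ev: "\<forall>\<^sub>F n in sequentially. ereal (r - u n) \<le> f n \<and> f n \<le> ereal (r + u n)"
    using assms(2)
  proof eventually_elim
    case (elim n)
    then show ?case by (cases "f n") (auto simp: r abs_le_iff)
  qed
  have "(\<lambda>n. ereal (r - u n)) \<longlonglongrightarrow> ereal r" "(\<lambda>n. ereal (r + u n)) \<longlonglongrightarrow> ereal r"
    using tendsto_diff[OF tendsto_const assms(3), of r] tendsto_add[OF tendsto_const assms(3), of r] by simp_all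
  then show ?thesis
    unfolding r using ev by (intro tendsto_sandwich[of _ f sequentially]) (auto elim: eventually_mono)
qed

text \<open>One estimate yields both claims of the theorem, because \<open>C\<close> is chosen
  before the modulus \<open>w\<close>.\<close>

lemma discretization_error:
  fixes a b :: "nat \<Rightarrow> real" and c :: "nat \<Rightarrow> nat \<Rightarrow> real"
  assumes dyadic: "\<forall>i\<in>{1..T}. a i \<in> dyadic \<and> b i \<in> dyadic"
    and bounds: "\<forall>i\<in>{1..T}. 0 \<le> a i \<and> a i < 1 \<and> 1 < b i"
    and a_decreasing: "\<forall>i\<in>{1..T}. \<forall>j\<in>{1..T}. i < j \<longrightarrow> a j < a i"
    and b_increasing: "\<forall>i\<in>{1..T}. \<forall>j\<in>{1..T}. i < j \<longrightarrow> b i < b j"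
    and g_continuous: "\<forall>j<e. continuous_on (paths T (price_range a b)) (g j)"
    and \<Phi>_continuous: "\<forall>t\<in>{0..T}. continuous_on (paths T (price_range a b)) (\<Phi> t)"
    and no_arbitrage: "\<forall>H\<in>strategies T (price_range a b). \<forall>h::nat \<Rightarrow> real. (\<exists>j<e. h j \<noteq> 0) \<longrightarrow>
          (\<exists>s\<in>paths T (price_range a b). gain T H s + (\<Sum>j<e. h j * g j s) < 0)"
    and c_null: "(\<lambda>n. sup_norm e (c n)) \<longlonglongrightarrow> 0"
  shows "\<bar>price T a b e g \<Phi>\<bar> \<noteq> \<infinity> \<and>
    (\<exists>C\<ge>0. \<forall>w. (\<forall>j<e. rounding_modulus T (price_range a b) (g j) w) \<longrightarrow>
      (\<forall>t\<in>{0..T}. rounding_modulus T (price_range a b) (\<Phi> t) w) \<longrightarrow>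
      (\<forall>\<^sub>F n in sequentially. \<bar>discrete_price T a b e g (c n) \<Phi> n - price T a b e g \<Phi>\<bar>
        \<le> ereal (C * (w n + sup_norm e (c n) + 1 / 2 ^ n))))"
proof -
  let ?X = "price_range a b" and ?Y = "grid_price_range a b"
  let ?q = "\<lambda>n. sup_norm e (c n)"
  obtain d B where market: "\<And>\<Gamma>. 1 \<in> \<Gamma> \<Longrightarrow> (\<forall>i\<in>{1..T}. a i \<in> \<Gamma> \<and> b i \<in> \<Gamma>) \<Longrightarrow>
      market T (\<lambda>i. ?X i \<inter> \<Gamma>) d B"
    using market_price_range[OF bounds a_decreasing b_increasing] by blast
  interpret X: market T ?X d B
    using market[of UNIV] by simp
  have compact: "compact (paths T ?X)"
    by (rule compact_paths) (simp add: price_range_def)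
  obtain G where G: "0 \<le> G" "\<And>j s. j < e \<Longrightarrow> s \<in> paths T ?X \<Longrightarrow> \<bar>g j s\<bar> \<le> G"
    using compact_family_bounded[of "{..<e}", OF _ compact, of g] g_continuous by auto
  obtain M where M: "0 \<le> M" "\<And>k s. k \<le> T \<Longrightarrow> s \<in> paths T ?X \<Longrightarrow> \<bar>\<Phi> k s\<bar> \<le> M"
    using compact_family_bounded[of "{0..T}", OF _ compact, of \<Phi>] \<Phi>_continuous by auto
  obtain \<delta> where coercive: "coercive T ?X e g \<delta>"
    using X.coercive[where e = e and g = g and G = G] G no_arbitrage by blast
  then have \<delta>: "0 < \<delta>" by (simp add: coercive_def)
  have lower: "ereal (- M) \<le> price T a b e g \<Phi>" and upper: "price T a b e g \<Phi> \<le> ereal M"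
    unfolding price_def
    using X.price_ge_payoff_bound[OF coercive, of \<Phi> M] X.price_le_payoff_bound[of \<Phi> M] M by auto
  \<comment> \<open>The bound on static positions from \<open>price_le_price_add\<close>, taken with
    the halved constant \<open>\<delta> / 2\<close> that holds on fine grids.\<close>
  define \<rho> where "\<rho> = 2 * M / (\<delta> / 2)"
  have \<rho>: "0 \<le> \<rho>" using M \<delta> by (simp add: \<rho>_def)
  define C where "C = 1 + \<rho> + 2 * real T * X.A * (2 * M + \<rho> * (G + 1))"
  have C: "0 \<le> C"
    unfolding C_def using \<rho> M G X.A_nonneg by simp
  have "\<forall>\<^sub>F n in sequentially. \<bar>discrete_price T a b e g (c n) \<Phi> n - price T a b e g \<Phi>\<bar>
        \<le> ereal (C * (w n + ?q n + 1 / 2 ^ n))"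
    if wg: "\<forall>j<e. rounding_modulus T ?X (g j) w" and w\<Phi>: "\<forall>t\<in>{0..T}. rounding_modulus T ?X (\<Phi> t) w" for w
  proof -
    \<comment> \<open>The loss of coercivity from \<open>coercive_coarse\<close> with rounding error
      \<open>1 / 2 ^ n\<close>. It tends to 0 and so eventually leaves at least
      \<open>\<delta> / 2\<close>.\<close>
    define \<epsilon> where "\<epsilon> n = w n + ?q n + 2 * real T * X.A * (\<delta> + G + ?q n) * (1 / 2 ^ n)" for n
    have w: "w \<longlonglongrightarrow> 0" "\<And>n. 0 \<le> w n"
      using w\<Phi> by (auto simp: rounding_modulus_def)
    have "(\<lambda>n. w n + ?q n + 2 * real T * X.A * (\<delta> + G + ?q n) * (1 / 2 ^ n))
        \<longlonglongrightarrow> 0 + 0 + 2 * real T * X.A * (\<delta> + G + 0) * 0"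
      by (intro tendsto_intros w c_null inverse_power_two_tendsto)
    then have "\<epsilon> \<longlonglongrightarrow> 0"
      unfolding \<epsilon>_def[abs_def] by simp
    from order_tendstoD(2)[OF this, of "\<delta> / 2"] have "\<forall>\<^sub>F n in sequentially. \<epsilon> n < \<delta> / 2"
      using \<delta> by simp
    moreover have "\<forall>\<^sub>F n in sequentially. ?q n < 1"
      using order_tendstoD(2)[OF c_null, of 1] by simp
    moreover have "\<forall>\<^sub>F n in sequentially. \<forall>i\<in>{1..T}. a i \<in> grid n \<and> b i \<in> grid n"
      using dyadic by (intro eventually_ball_finite ballI eventually_conj eventually_in_grid) simp_all
    moreover have "\<forall>\<^sub>F n in sequentially. \<forall>j\<in>{..<e}. \<forall>s\<in>paths T ?X.
        \<bar>g j s - g j (round_path T (round_down n) s)\<bar> \<le> w n"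
      using wg by (intro eventually_ball_finite[OF finite_lessThan] ballI) (simp add: rounding_modulus_def)
    moreover have "\<forall>\<^sub>F n in sequentially. \<forall>k\<in>{0..T}. \<forall>s\<in>paths T ?X.
        \<bar>\<Phi> k s - \<Phi> k (round_path T (round_down n) s)\<bar> \<le> w n"
      using w\<Phi> by (intro eventually_ball_finite[OF finite_atLeastAtMost] ballI) (simp add: rounding_modulus_def)
    ultimately show ?thesis
    proof eventually_elim
      case (elim n)
      have "grid_price_range a b n = (\<lambda>i. ?X i \<inter> grid n)"
        by (auto simp: grid_price_range_def)
      then interpret Y: market T "?Y n" d B
        using market[OF one_in_grid elim(3)] by simp
      interpret rounded_market T ?X "?Y n" d B e g \<Phi> "c n" "round_down n" "1 / 2 ^ n" "w n" "?q n" G M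
      proof unfold_locales
        show "?Y n i \<subseteq> ?X i" for i
          by (auto simp: grid_price_range_def)
        show "round_down n y \<in> ?Y n i" if "i \<le> T" "y \<in> ?X i" for i y
          using elim(3) bounds that by (intro round_down_price_range) auto
        show "\<bar>g j s - g j (round_path T (round_down n) s)\<bar> \<le> w n" if "j < e" "s \<in> paths T ?X" for j s
          using elim(4) that by simp
        show "\<bar>\<Phi> k s - \<Phi> k (round_path T (round_down n) s)\<bar> \<le> w n" if "k \<le> T" "s \<in> paths T ?X" for k s
          using elim(5) that by simp
      qed (fact round_down_error G M abs_le_sup_norm sup_norm_nonneg)+
      have "coercive T (?Y n) e (\<lambda>j s. g j s - c n j) (\<delta> - \<epsilon> n)"
        unfolding \<epsilon>_def using coercive_coarse[OF coercive] elim(1) \<delta> by (simp add: \<epsilon>_def)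
      then have "coercive T (?Y n) e (\<lambda>j s. g j s - c n j) (\<delta> / 2)"
        by (rule coercive_mono) (use elim(1) \<delta> in auto)
      note fine = fine_price_le[OF this]
      \<comment> \<open>The left side is the error of \<open>fine_price_le\<close>; since
        \<open>?q n < 1\<close>, its trading term has a coefficient independent of
        \<open>n\<close>.\<close>
      have "w n + \<rho> * (w n + ?q n) + real T * (X.A * (2 * M + \<rho> * (G + ?q n)) * (2 * (1 / 2 ^ n)))
          \<le> C * (w n + ?q n + 1 / 2 ^ n)"
      proof -
        let ?D = "2 * real T * X.A * (2 * M + \<rho> * (G + 1))"
        have "real T * (X.A * (2 * M + \<rho> * (G + ?q n)) * (2 * (1 / 2 ^ n)))
            = 2 * real T * X.A * (2 * M + \<rho> * (G + ?q n)) * (1 / 2 ^ n)"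
          by simp
        also have "\<dots> \<le> ?D * (1 / 2 ^ n)"
          using elim(2) \<rho> X.A_nonneg by (intro mult_right_mono mult_left_mono add_left_mono) auto
        finally have "real T * (X.A * (2 * M + \<rho> * (G + ?q n)) * (2 * (1 / 2 ^ n))) \<le> ?D * (1 / 2 ^ n)" .
        moreover have "C * (w n + ?q n + 1 / 2 ^ n) =
            w n + \<rho> * (w n + ?q n) + ?D * (1 / 2 ^ n) + (?q n + 1 / 2 ^ n + \<rho> * (1 / 2 ^ n) + ?D * (w n + ?q n))"
          unfolding C_def by (simp add: algebra_simps)
        moreover have "0 \<le> ?q n + 1 / 2 ^ n + \<rho> * (1 / 2 ^ n) + ?D * (w n + ?q n)"
          using w(2)[of n] q_nonneg \<rho> M G X.A_nonneg by simp
        ultimately show ?thesis by linarith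
      qed
      then have fine': "price T a b e g \<Phi> \<le> discrete_price T a b e g (c n) \<Phi> n + ereal (C * (w n + ?q n + 1 / 2 ^ n))"
        using fine unfolding price_def discrete_price_def \<rho>_def
        by (meson add_left_mono ereal_less_eq(3) order_trans)
      have "2 * M / \<delta> * ?q n \<le> \<rho> * ?q n"
        using M \<delta> q_nonneg by (intro mult_right_mono) (auto simp: \<rho>_def field_simps)
      also have "\<dots> \<le> C * (w n + ?q n + 1 / 2 ^ n)"
        using w(2)[of n] q_nonneg \<rho> M G X.A_nonneg C by (intro mult_mono) (auto simp: C_def)
      finally have "discrete_price T a b e g (c n) \<Phi> n \<le> price T a b e g \<Phi> + ereal (C * (w n + ?q n + 1 / 2 ^ n))"
        using coarse_price_le[OF coercive] unfolding price_def discrete_price_def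
        by (meson add_left_mono ereal_less_eq(3) order_trans)
      then show ?case
        using lower upper fine' by (intro abs_ereal_diff_le)
    qed
  qed
  then have "\<exists>C\<ge>0. \<forall>w. (\<forall>j<e. rounding_modulus T ?X (g j) w) \<longrightarrow>
      (\<forall>t\<in>{0..T}. rounding_modulus T ?X (\<Phi> t) w) \<longrightarrow>
      (\<forall>\<^sub>F n in sequentially. \<bar>discrete_price T a b e g (c n) \<Phi> n - price T a b e g \<Phi>\<bar>
        \<le> ereal (C * (w n + ?q n + 1 / 2 ^ n)))"
    using C by blast
  moreover have "\<bar>price T a b e g \<Phi>\<bar> \<noteq> \<infinity>"
    using lower upper by (cases "price T a b e g \<Phi>") auto
  ultimately show ?thesis by (intro conjI)
qed

section \<open>Convergence of the prices and its rate\<close>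

theorem theorem4p3:
  fixes T e :: nat
    and a b :: "nat \<Rightarrow> real"
    and g :: "nat \<Rightarrow> path \<Rightarrow> real"
    and \<Phi> :: "nat \<Rightarrow> path \<Rightarrow> real"
    and c :: "nat \<Rightarrow> nat \<Rightarrow> real"
  assumes dyadic: "\<forall>i\<in>{1..T}. a i \<in> dyadic \<and> b i \<in> dyadic"
    and bounds: "\<forall>i\<in>{1..T}. 0 \<le> a i \<and> a i < 1 \<and> 1 < b i"
    and a_decreasing: "\<forall>i\<in>{1..T}. \<forall>j\<in>{1..T}. i < j \<longrightarrow> a j < a i"
    and b_increasing: "\<forall>i\<in>{1..T}. \<forall>j\<in>{1..T}. i < j \<longrightarrow> b i < b j"
    and adapted: "adapted_payoff T (price_range a b) \<Phi>"
    and g_continuous: "\<forall>j<e. continuous_on (paths T (price_range a b)) (g j)"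
    and \<Phi>_continuous: "\<forall>t\<in>{0..T}. continuous_on (paths T (price_range a b)) (\<Phi> t)"
    and no_arbitrage: "\<forall>H\<in>strategies T (price_range a b). \<forall>h::nat \<Rightarrow> real. (\<exists>j<e. h j \<noteq> 0) \<longrightarrow>
          (\<exists>s\<in>paths T (price_range a b). gain T H s + (\<Sum>j<e. h j * g j s) < 0)"
    and c_null: "(\<lambda>n. sup_norm e (c n)) \<longlonglongrightarrow> 0"
  shows "((\<lambda>n. discrete_price T a b e g (c n) \<Phi> n) \<longlonglongrightarrow> price T a b e g \<Phi>) \<and>
    ((\<forall>j<e. lipschitz_paths T (paths T (price_range a b)) (g j)) \<and>
     (\<forall>t\<in>{0..T}. lipschitz_paths T (paths T (price_range a b)) (\<Phi> t)) \<and>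
     (\<lambda>n. sup_norm e (c n)) \<in> O(\<lambda>n. 1 / 2 ^ n) \<longrightarrow>
       (\<exists>C::real. \<forall>\<^sub>F n in sequentially.
          \<bar>discrete_price T a b e g (c n) \<Phi> n - price T a b e g \<Phi>\<bar> \<le> ereal (C * (1 / 2 ^ n))))"
proof -
  let ?X = "price_range a b" and ?q = "\<lambda>n. sup_norm e (c n)"
  let ?err = "\<lambda>n. \<bar>discrete_price T a b e g (c n) \<Phi> n - price T a b e g \<Phi>\<bar>"
  note discretization_error = discretization_error[OF dyadic bounds a_decreasing b_increasing
      g_continuous \<Phi>_continuous no_arbitrage c_null]
  have finite: "\<bar>price T a b e g \<Phi>\<bar> \<noteq> \<infinity>"
    using discretization_error by (rule conjunct1)
  from discretization_error[THEN conjunct2]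
  obtain C where C: "0 \<le> C" and all_moduli: "\<forall>w. (\<forall>j<e. rounding_modulus T ?X (g j) w) \<longrightarrow>
      (\<forall>t\<in>{0..T}. rounding_modulus T ?X (\<Phi> t) w) \<longrightarrow>
      (\<forall>\<^sub>F n in sequentially. ?err n \<le> ereal (C * (w n + ?q n + 1 / 2 ^ n)))"
    by (elim exE conjE)
  note error = all_moduli[THEN spec, THEN mp, THEN mp]
  have compact: "compact (paths T ?X)"
    by (rule compact_paths) (simp add: price_range_def)
  have "(\<lambda>i\<in>{0..T}. 1) \<in> paths T ?X"
    using bounds by (auto simp: paths_def price_range_def less_imp_le)
  then have nonempty: "paths T ?X \<noteq> {}" by blast
  have "\<forall>\<^sub>F n in sequentially. \<forall>i\<in>{1..T}. a i \<in> grid n"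
    using dyadic by (intro eventually_ball_finite ballI eventually_in_grid) simp_all
  then have into: "\<forall>\<^sub>F n in sequentially. \<forall>s\<in>paths T ?X. round_path T (round_down n) s \<in> paths T ?X"
  proof eventually_elim
    case (elim n)
    have "round_down n y \<in> ?X i" if "i \<le> T" "y \<in> ?X i" for i y
      using round_down_price_range[of i a n y b] elim bounds that by (auto simp: grid_price_range_def)
    then show ?case
      by (blast intro: round_path_in)
  qed
  \<comment> \<open>All static payoffs and all dates of the American payoff are indexed together, so
    that a single modulus covers them.\<close>
  define I where "I = {..<e} <+> {0..T}"
  define f where "f i = (case i of Inl j \<Rightarrow> g j | Inr t \<Rightarrow> \<Phi> t)" for i
  have I: "finite I" by (simp add: I_def)
  have common: "(\<forall>j<e. rounding_modulus T ?X (g j) (\<lambda>n. \<Sum>i\<in>I. w i n)) \<and>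
      (\<forall>t\<in>{0..T}. rounding_modulus T ?X (\<Phi> t) (\<lambda>n. \<Sum>i\<in>I. w i n))"
    if "\<And>i. i \<in> I \<Longrightarrow> rounding_modulus T ?X (f i) (w i)" for w
  proof -
    have "rounding_modulus T ?X (f i) (\<lambda>n. \<Sum>i\<in>I. w i n)" if "i \<in> I" for i
      using I \<open>\<And>i. i \<in> I \<Longrightarrow> rounding_modulus T ?X (f i) (w i)\<close> that by (rule rounding_modulus_family)
    note family = this
    have "rounding_modulus T ?X (g j) (\<lambda>n. \<Sum>i\<in>I. w i n)" if "j < e" for j
      using family[of "Inl j"] that by (simp add: f_def) (simp add: I_def InlI)
    moreover have "rounding_modulus T ?X (\<Phi> t) (\<lambda>n. \<Sum>i\<in>I. w i n)" if "t \<in> {0..T}" for t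
      using family[of "Inr t"] that by (simp add: f_def) (simp add: I_def InrI)
    ultimately show ?thesis by blast
  qed
  have "\<exists>w. rounding_modulus T ?X (f i) w" if "i \<in> I" for i
    using that g_continuous \<Phi>_continuous
    by (intro continuous_rounding_modulus[OF compact nonempty _ into]) (auto simp: I_def f_def)
  then obtain w where w: "\<And>i. i \<in> I \<Longrightarrow> rounding_modulus T ?X (f i) (w i)"
    by metis
  have "(\<lambda>n. \<Sum>i\<in>I. w i n) \<longlonglongrightarrow> 0"
    using common[OF w] by (auto simp: rounding_modulus_def)
  then have "(\<lambda>n. C * ((\<Sum>i\<in>I. w i n) + ?q n + 1 / 2 ^ n)) \<longlonglongrightarrow> C * (0 + 0 + 0)"
    by (intro tendsto_intros c_null inverse_power_two_tendsto)
  then have limit: "(\<lambda>n. discrete_price T a b e g (c n) \<Phi> n) \<longlonglongrightarrow> price T a b e g \<Phi>"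
    using error common[OF w] by (intro tendsto_ereal_error[OF finite]) auto
  have rate: "\<exists>C::real. \<forall>\<^sub>F n in sequentially. ?err n \<le> ereal (C * (1 / 2 ^ n))"
    if lipschitz: "\<forall>j<e. lipschitz_paths T (paths T ?X) (g j)"
      "\<forall>t\<in>{0..T}. lipschitz_paths T (paths T ?X) (\<Phi> t)"
      and q: "?q \<in> O(\<lambda>n. 1 / 2 ^ n)"
  proof -
    have "\<exists>L\<ge>0. rounding_modulus T ?X (f i) (\<lambda>n. L * (1 / 2 ^ n))" if "i \<in> I" for i
      using that lipschitz by (intro lipschitz_rounding_modulus[OF _ into]) (auto simp: I_def f_def)
    then obtain L where L: "\<And>i. i \<in> I \<Longrightarrow> rounding_modulus T ?X (f i) (\<lambda>n. L i * (1 / 2 ^ n))"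
      by metis
    obtain k where k: "\<forall>\<^sub>F n in sequentially. norm (?q n) \<le> k * norm (1 / 2 ^ n :: real)"
      using landau_o.bigE[OF q] by blast
    \<comment> \<open>With Lipschitz moduli, every term of the error bound is a multiple of
      \<open>1 / 2 ^ n\<close>, the option prices by the assumption on \<open>?q\<close>.\<close>
    have "\<forall>\<^sub>F n in sequentially. ?err n \<le> ereal (C * ((\<Sum>i\<in>I. L i * (1 / 2 ^ n)) + ?q n + 1 / 2 ^ n))"
      using error common[OF L] by blast
    then have "\<forall>\<^sub>F n in sequentially. ?err n \<le> ereal (C * ((\<Sum>i\<in>I. L i) + k + 1) * (1 / 2 ^ n))"
      using k
    proof eventually_elim
      case (elim n)
      have "C * ((\<Sum>i\<in>I. L i * (1 / 2 ^ n)) + ?q n + 1 / 2 ^ n)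
          \<le> C * ((\<Sum>i\<in>I. L i) * (1 / 2 ^ n) + k * (1 / 2 ^ n) + 1 / 2 ^ n)"
        using elim(2) C by (intro mult_left_mono) (auto simp: sum_divide_distrib)
      also have "\<dots> = C * ((\<Sum>i\<in>I. L i) + k + 1) * (1 / 2 ^ n)"
        by (simp add: algebra_simps add_divide_distrib)
      finally show ?case
        using elim(1) by (meson ereal_less_eq(3) order_trans)
    qed
    then show ?thesis by blast
  qed
  show ?thesis
    using limit rate by blast
qed

end
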